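(* Let $C$ be the non-complete intersection Gorenstein monomial curve $x_i=t^{n_i}$ ($1\le i\le4$) in $\mathbb{A}^4(K)$, with $n_1<n_2<n_3<n_4$. Suppose that $I(C)$ is given as in case 1(b), i.e. $I(C)$ is minimally generated by $$f_1=x_1^{a_1}-x_3^{a_{13}}x_4^{a_{14}},\quad f_2=x_2^{a_2}-x_1^{a_{21}}x_3^{a_{23}},\quad f_3=x_3^{a_3}-x_2^{a_{32}}x_4^{a_{34}},$$ $$f_4=x_4^{a_4}-x_1^{a_{41}}x_2^{a_{42}},\quad f_5=x_1^{a_{21}}x_4^{a_{34}}-x_2^{a_{42}}x_3^{a_{13}},$$ and also that $a_{32}<a_{42}$. Assume that $a_{14}\le a_{34}$. Then $C$ has Cohen-Macaulay tangent cone at the origin if and only if (1) $a_2\le a_{21}+a_{23}$, (2) $a_{42}+a_{13}\le a_{21}+a_{34}$, and (3) $a_3+a_{13}\le a_1+a_{32}+a_{34}-a_{14}$.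
   Context: $K$ is a field and $n_1,\dots,n_4$ are positive integers with $\gcd(n_1,\dots,n_4)=1$. $I(C)$ is the kernel of the $K$-algebra homomorphism $K[x_1,\dots,x_4]\to K[t]$, $x_i\mapsto t^{n_i}$. $C$ is Gorenstein if the semigroup $\mathcal{S}=\{g_1n_1+\cdots+g_4n_4: g_i\in\mathbb{N}\}$ is symmetric ($\mathbb{N}$ = non-negative integers). In the description of $I(C)$, all exponents are integers with $0<a_{ij}<a_j$, and (by Bresinsky) $a_1=a_{21}+a_{41}$, $a_2=a_{32}+a_{42}$, $a_3=a_{13}+a_{23}$, $a_4=a_{14}+a_{34}$. $C$ has Cohen-Macaulay tangent cone at the origin if the ring $K[x_1,\dots,x_4]/I(C)_*$ is Cohen-Macaulay, where $I(C)_*$ is generated by the homogeneous (standard grading) summands $f_*$ of least degree of the polynomials $f\in I(C)$. *)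

theory Defs
  imports
    "HOL-Algebra.QuotRing"
    "HOL-Algebra.Ring_Divisibility"
    "HOL-Computational_Algebra.Polynomial"
    "HOL-Library.Poly_Mapping"
    "HOL-Library.Numeral_Type"
    "HOL-Library.Extended_Nat"
begin

section \<open>Cohen--Macaulay rings\<close>

definition regular_sequence :: "('a, 'b) ring_scheme \<Rightarrow> 'a list \<Rightarrow> bool" where
  "regular_sequence R as \<longleftrightarrow>
     set as \<subseteq> carrier R \<and>
     (\<forall>i < length as. \<forall>b \<in> carrier R.
        as ! i \<otimes>\<^bsub>R\<^esub> b \<in> Idl\<^bsub>R\<^esub> (set (take i as)) \<longrightarrow> b \<in> Idl\<^bsub>R\<^esub> (set (take i as))) \<and>
     Idl\<^bsub>R\<^esub> (set as) \<noteq> carrier R"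

definition ideal_depth :: "('a, 'b) ring_scheme \<Rightarrow> 'a set \<Rightarrow> enat" where
  "ideal_depth R I = (SUP as \<in> {as. regular_sequence R as \<and> set as \<subseteq> I}. enat (length as))"

definition prime_height :: "('a, 'b) ring_scheme \<Rightarrow> 'a set \<Rightarrow> enat" where
  "prime_height R P = (SUP k \<in> {k. \<exists>Q :: nat \<Rightarrow> 'a set.
     (\<forall>i\<le>k. primeideal (Q i) R) \<and> (\<forall>i<k. Q i \<subset> Q (Suc i)) \<and> Q k = P}. enat k)"

text \<open>This is the definition of Eisenbud, \<^emph>\<open>Commutative Algebra\<close>, Section 18.2, where rings are
  commutative and Noetherian: every maximal ideal has depth equal to its codimension.\<close>

definition cohen_macaulay :: "('a, 'b) ring_scheme \<Rightarrow> bool" where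
  "cohen_macaulay R \<longleftrightarrow> cring R \<and> noetherian_ring R \<and>
     (\<forall>P. maximalideal P R \<longrightarrow> ideal_depth R P = prime_height R P)"


section \<open>Polynomials in finitely many variables\<close>

text \<open>A monomial is its exponent vector; the product of \<^typ>\<open>'m \<Rightarrow>\<^sub>0 'k\<close> is convolution.\<close>

type_synonym ('x, 'k) mpoly = "('x \<Rightarrow>\<^sub>0 nat) \<Rightarrow>\<^sub>0 'k"

definition mpoly_ring :: "('x, 'k::comm_ring_1) mpoly ring" where
  "mpoly_ring = \<lparr>carrier = UNIV, monoid.mult = (*), one = 1, zero = 0, add = (+)\<rparr>"

lemma cring_mpoly_ring: "cring (mpoly_ring :: ('x, 'k::comm_ring_1) mpoly ring)"
proof (rule cringI)
  show "abelian_group (mpoly_ring :: ('x, 'k) mpoly ring)"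
    by (rule abelian_groupI)
      (auto simp: mpoly_ring_def add.assoc add.commute intro: exI[of _ "- x" for x])
  show "Group.comm_monoid (mpoly_ring :: ('x, 'k) mpoly ring)"
    by (rule comm_monoidI) (auto simp: mpoly_ring_def mult.assoc mult.commute)
qed (auto simp: mpoly_ring_def distrib_right)

definition var :: "'x \<Rightarrow> ('x, 'k::comm_ring_1) mpoly" where
  "var i = Poly_Mapping.single (Poly_Mapping.single i 1) 1"

abbreviation ideal_gen :: "('x, 'k::comm_ring_1) mpoly set \<Rightarrow> ('x, 'k) mpoly set" where
  "ideal_gen F \<equiv> Idl\<^bsub>mpoly_ring\<^esub> F"

definition minimally_generates ::
    "('x, 'k::comm_ring_1) mpoly set \<Rightarrow> ('x, 'k) mpoly set \<Rightarrow> bool" where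
  "minimally_generates F I \<longleftrightarrow> ideal_gen F = I \<and> (\<forall>G. G \<subset> F \<longrightarrow> ideal_gen G \<noteq> I)"

definition homogeneous_component ::
    "nat \<Rightarrow> ('x::finite, 'k::comm_ring_1) mpoly \<Rightarrow> ('x, 'k) mpoly" where
  "homogeneous_component d f =
     (\<Sum>m \<in> {m \<in> Poly_Mapping.keys f. (\<Sum>i\<in>UNIV. Poly_Mapping.lookup m i) = d}.
        Poly_Mapping.single m (Poly_Mapping.lookup f m))"

text \<open>The summand of least degree; it is \<open>0\<close> for \<open>f = 0\<close>, whatever the \<open>LEAST\<close> is.\<close>

definition initial_form :: "('x::finite, 'k::comm_ring_1) mpoly \<Rightarrow> ('x, 'k) mpoly" where
  "initial_form f = homogeneous_component (LEAST d. homogeneous_component d f \<noteq> 0) f"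

definition initial_ideal :: "('x::finite, 'k::comm_ring_1) mpoly set \<Rightarrow> ('x, 'k) mpoly set" where
  "initial_ideal I = ideal_gen (initial_form ` I)"


section \<open>Monomial curves\<close>

text \<open>Curves in affine 4-space use the index type \<^typ>\<open>4\<close>, whose elements are \<open>1\<close>, \<open>2\<close>, \<open>3\<close>
  and \<open>4\<close>, the last of which is also \<open>0\<close>.\<close>

text \<open>The \<open>K\<close>-algebra homomorphism with \<open>x\<^sub>i \<mapsto> t\<close> to the power \<open>n i\<close>.\<close>

definition curve_map :: "('x::finite \<Rightarrow> nat) \<Rightarrow> ('x, 'k::field) mpoly \<Rightarrow> 'k poly" where
  "curve_map n f = (\<Sum>m \<in> Poly_Mapping.keys f.
     Polynomial.monom (Poly_Mapping.lookup f m) (\<Sum>i\<in>UNIV. n i * Poly_Mapping.lookup m i))"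

lemma curve_map_superset:
  assumes "finite A" and "Poly_Mapping.keys f \<subseteq> A"
  shows "curve_map n f = (\<Sum>m\<in>A. Polynomial.monom (Poly_Mapping.lookup f m)
           (\<Sum>i\<in>UNIV. n i * Poly_Mapping.lookup m i))"
  unfolding curve_map_def
  by (rule sum.mono_neutral_left) (use assms in \<open>auto simp: in_keys_iff\<close>)

lemma curve_map_single:
  "curve_map n (Poly_Mapping.single m c) =
     Polynomial.monom c (\<Sum>i\<in>UNIV. n i * Poly_Mapping.lookup m i)"
  by (cases "c = 0") (simp_all add: curve_map_def)

lemma curve_map_add: "curve_map n (f + g) = curve_map n f + curve_map n g"
proof -
  let ?A = "Poly_Mapping.keys f \<union> Poly_Mapping.keys g"
  have "curve_map n h = (\<Sum>m\<in>?A. Polynomial.monom (Poly_Mapping.lookup h m)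
           (\<Sum>i\<in>UNIV. n i * Poly_Mapping.lookup m i))"
    if "Poly_Mapping.keys h \<subseteq> ?A" for h
    using that by (intro curve_map_superset) auto
  from this[OF Poly_Mapping.keys_add] this[of f] this[of g] show ?thesis
    by (simp add: lookup_add sum.distrib flip: add_monom)
qed

lemma curve_map_const [simp]: "curve_map n (Poly_Mapping.single 0 c) = [:c:]"
  by (simp add: curve_map_single monom_0)

lemma curve_map_var [simp]: "curve_map n (var i) = Polynomial.monom 1 (n i)"
  by (simp add: var_def curve_map_single lookup_single when_def if_distrib cong: if_cong)

lemma mpoly_additive_induct [case_names single add]:
  assumes single: "\<And>m c. P (Poly_Mapping.single m c)"
    and add: "\<And>f g. P f \<Longrightarrow> P g \<Longrightarrow> P (f + g)"
  shows "P (f :: ('x, 'k::comm_ring_1) mpoly)"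
proof -
  have "P (\<Sum>m\<in>A. Poly_Mapping.single m (Poly_Mapping.lookup f m))" if "finite A" for A
    using that by induction (use single[of 0 0] in \<open>auto intro: single add\<close>)
  moreover have "f = (\<Sum>m\<in>Poly_Mapping.keys f. Poly_Mapping.single m (Poly_Mapping.lookup f m))"
    by (rule poly_mapping_eqI)
      (simp add: lookup_sum lookup_single when_def in_keys_iff)
  ultimately show ?thesis by (metis finite_keys)
qed

lemma curve_map_mult: "curve_map n (f * g) = curve_map n f * curve_map n g"
proof (induction f rule: mpoly_additive_induct)
  case (single m c)
  show ?case
  proof (induction g rule: mpoly_additive_induct)
    case (single m' c')
    then show ?case
      by (simp add: mult_single curve_map_single mult_monom lookup_add
          distrib_left sum.distrib)
  next
    case (add g h)
    then show ?case by (simp add: distrib_left curve_map_add)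
  qed
next
  case (add f h)
  then show ?case by (simp add: distrib_right curve_map_add)
qed

definition curve_ideal :: "('x::finite \<Rightarrow> nat) \<Rightarrow> ('x, 'k::field) mpoly set" where
  "curve_ideal n = {f. curve_map n f = 0}"

text \<open>The ideal of the curve has height \<open>CARD('x) - 1\<close>.\<close>

definition complete_intersection_curve :: "'k::field itself \<Rightarrow> ('x::finite \<Rightarrow> nat) \<Rightarrow> bool" where
  "complete_intersection_curve _ n \<longleftrightarrow>
     (\<exists>F :: ('x, 'k) mpoly set. finite F \<and> card F = CARD('x) - 1 \<and> ideal_gen F = curve_ideal n)"

definition curve_semigroup :: "('x::finite \<Rightarrow> nat) \<Rightarrow> nat set" where
  "curve_semigroup n = {s. \<exists>g :: 'x \<Rightarrow> nat. s = (\<Sum>i\<in>UNIV. g i * n i)}"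

text \<open>The largest integer outside \<open>S\<close>; it is \<open>-1\<close> for \<open>S = UNIV\<close>.\<close>

definition frobenius_number :: "nat set \<Rightarrow> int" where
  "frobenius_number S = (GREATEST z. z \<notin> int ` S)"

definition symmetric_semigroup :: "nat set \<Rightarrow> bool" where
  "symmetric_semigroup S \<longleftrightarrow>
     (\<forall>z :: int. z \<in> int ` S \<longleftrightarrow> frobenius_number S - z \<notin> int ` S)"

definition gorenstein_curve :: "('x::finite \<Rightarrow> nat) \<Rightarrow> bool" where
  "gorenstein_curve n \<longleftrightarrow> symmetric_semigroup (curve_semigroup n)"

definition cohen_macaulay_tangent_cone :: "'k::field itself \<Rightarrow> ('x::finite \<Rightarrow> nat) \<Rightarrow> bool" where
  "cohen_macaulay_tangent_cone _ n \<longleftrightarrow>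
     cohen_macaulay (mpoly_ring Quot initial_ideal (curve_ideal n :: ('x, 'k) mpoly set))"

end

theory Submission
  imports Defs "HOL-Analysis.Cartesian_Space"
begin

text \<open>
Give \<open>x\<^sub>i\<close> the weight \<open>n i\<close>, so that \<open>x\<^sup>m \<mapsto> t\<^sup>w\<close> with \<open>w\<close> the weight of \<open>m\<close>. Call \<open>m\<close> degree-maximal
  if no exponent vector of the same weight has larger total degree. The tangent cone forgets all
  other monomials: the linear map \<open>leading_image\<close>, which sends \<open>x\<^sup>m\<close> to \<open>t\<^sup>w\<close> if \<open>m\<close> is degree-maximal
  and to \<open>0\<close> otherwise, has kernel \<open>I(C)\<^sub>*\<close> (\<open>initial_ideal_curve_ideal\<close>).

  Since \<open>n 1\<close> is the least weight, a power of each of \<open>x\<^sub>2\<close>, \<open>x\<^sub>3\<close>, \<open>x\<^sub>4\<close> lies in \<open>I(C)\<^sub>*\<close>, while no power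
  of \<open>x\<^sub>1\<close> does. So the ring \<open>A\<close> of the tangent cone is a finite \<open>K[x\<^sub>1]\<close>-algebra that becomes \<open>K[x\<^sub>1]\<close>
  modulo nilpotents. All maximal ideals of such an \<open>A\<close> have height 1 and depth at most 1, and \<open>A\<close> is
  Cohen--Macaulay if and only if it is torsion-free over \<open>K[x\<^sub>1]\<close>, if and only if \<open>x\<^sub>1\<close> is a
  nonzerodivisor. In terms of monomials this says that \<open>m + e\<^sub>1\<close> is degree-maximal whenever \<open>m\<close> is
  (\<open>cohen_macaulay_tangent_cone_iff\<close>), or: if some monomial of a given weight is divisible by
  \<open>x\<^sub>1\<close>, then so is some monomial of that weight whose degree is maximal
  (\<open>degree_maximal_add_axis_iff\<close>).

  The generators are differences of two monomials. Replacing one of the two by the other inside a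
  larger monomial is a move. Two monomials have equal weight only if moves connect them, that is,
  every set of monomials that moves do not leave is a union of sets of equal weight
  (\<open>move_closed_imp_weight_closed\<close>). This reduces the theorem to counting degrees in three weights
  and to one closed set (\<open>degree_condition_iff\<close>).

  Necessity: the monomials \<open>x\<^sub>2^a2\<close>, \<open>x\<^sub>2^a42 x\<^sub>3^a13\<close> and \<open>x\<^sub>3^(a3 + a13)\<close> share their weights with
  one, one and two other monomials, as the moves show. In each of the three lists exactly one
  monomial is divisible by \<open>x\<^sub>1\<close>. Conditions (1), (2) and (3) say that its degree is at least that of
  the monomial named.

  Sufficiency: the monomials that are divisible by \<open>x\<^sub>1\<close> or by one of
  \<open>x\<^sub>3^a13 x\<^sub>4^a14\<close>, \<open>x\<^sub>2^a2\<close>, \<open>x\<^sub>4^a4\<close>, \<open>x\<^sub>2^a42 x\<^sub>3^a13\<close>, \<open>x\<^sub>3^(a3 + a13)\<close>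
  form a set that moves do not leave. Hence any monomial with the same weight as a multiple of
  \<open>x\<^sub>1\<close> is in this set. Each of the five listed monomials has the weight of a multiple of \<open>x\<^sub>1\<close> of at
  least the same degree: for the first and the third because \<open>n 1\<close> is the least and \<open>n 4\<close> the
  greatest weight, for the others by (1), (2) and (3).
\<close>

section \<open>Algebras that are finite over a polynomial ring in one variable\<close>
lemma poly_ideal_principal:
  fixes I :: "'k::field poly set"
  assumes zero: "0 \<in> I" and add: "\<And>p q. p \<in> I \<Longrightarrow> q \<in> I \<Longrightarrow> p + q \<in> I"
    and mult: "\<And>p q. q \<in> I \<Longrightarrow> p * q \<in> I"
  shows "\<exists>g. \<forall>p. p \<in> I \<longleftrightarrow> g dvd p"
proof (cases "I \<subseteq> {0}")
  case True
  with zero have "p \<in> I \<longleftrightarrow> 0 dvd p" for p by auto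
  then show ?thesis by blast
next
  case False
  then obtain q where "q \<in> I \<and> q \<noteq> 0" by auto
  then obtain g where g: "g \<in> I" "g \<noteq> 0"
    and least: "\<And>q. q \<in> I \<Longrightarrow> q \<noteq> 0 \<Longrightarrow> euclidean_size g \<le> euclidean_size q"
    using arg_min_nat_lemma[of "\<lambda>q. q \<in> I \<and> q \<noteq> 0" q euclidean_size] by blast
  have "g dvd p" if "p \<in> I" for p
  proof -
    have "p mod g = p + (- (p div g)) * g"
      by (simp add: minus_div_mult_eq_mod [symmetric])
    then have "p mod g \<in> I" using add[OF that mult[OF g(1)]] by metis
    then have "p mod g = 0"
      using least[of "p mod g"] mod_size_less[of g p] g(2) by fastforce
    then show ?thesis by (simp add: dvd_eq_mod_eq_0)
  qed
  moreover have "p \<in> I" if "g dvd p" for p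
    using that mult[OF g(1)] by (metis dvdE mult.commute)
  ultimately show ?thesis by blast
qed

text \<open>\<open>\<rho>\<close> is the structure map of an algebra over \<open>K[X]\<close>. The algebra is a type and not a carrier set, so
  that statements about its quotients become statements modulo a set \<open>J\<close>.\<close>
locale poly_algebra =
  fixes \<rho> :: "'k::field poly \<Rightarrow> 'r::comm_ring_1"
  assumes \<rho>_add: "\<rho> (p + q) = \<rho> p + \<rho> q"
    and \<rho>_mult: "\<rho> (p * q) = \<rho> p * \<rho> q"
    and \<rho>_one: "\<rho> 1 = 1"
begin

lemma \<rho>_zero: "\<rho> 0 = 0"
  using \<rho>_add[of 0 0] by simp

lemma \<rho>_uminus: "\<rho> (- p) = - \<rho> p"
  using \<rho>_add[of p "- p"] by (simp add: \<rho>_zero add_eq_0_iff2)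

lemma \<rho>_power: "\<rho> (p ^ k) = \<rho> p ^ k"
  by (induction k) (simp_all add: \<rho>_one \<rho>_mult)

definition submodule :: "'r set \<Rightarrow> bool" where
  "submodule M \<longleftrightarrow> 0 \<in> M \<and> (\<forall>f\<in>M. \<forall>g\<in>M. f + g \<in> M) \<and> (\<forall>p. \<forall>f\<in>M. \<rho> p * f \<in> M)"

lemma submodule_uminus: "submodule M \<Longrightarrow> f \<in> M \<Longrightarrow> - f \<in> M"
  unfolding submodule_def
  by (metis \<rho>_uminus \<rho>_one mult_minus_left mult_1)

lemma submodule_diff: "submodule M \<Longrightarrow> f \<in> M \<Longrightarrow> g \<in> M \<Longrightarrow> f - g \<in> M"
  using submodule_uminus[of M g] unfolding submodule_def
  by (metis add_uminus_conv_diff)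

definition spans_mod :: "'r set \<Rightarrow> 'r set \<Rightarrow> 'r \<Rightarrow> bool" where
  "spans_mod J B f \<longleftrightarrow> (\<exists>c. f - (\<Sum>b\<in>B. \<rho> (c b) * b) \<in> J)"

lemma spans_mod_zero: "submodule J \<Longrightarrow> spans_mod J B 0"
  unfolding spans_mod_def by (rule exI[of _ "\<lambda>_. 0"]) (simp add: \<rho>_zero submodule_def)

lemma spans_mod_add:
  assumes J: "submodule J" and "spans_mod J B f" "spans_mod J B g"
  shows "spans_mod J B (f + g)"
proof -
  obtain c d where cd: "f - (\<Sum>b\<in>B. \<rho> (c b) * b) \<in> J" "g - (\<Sum>b\<in>B. \<rho> (d b) * b) \<in> J"
    using assms unfolding spans_mod_def by blast
  have "f + g - (\<Sum>b\<in>B. \<rho> (c b + d b) * b)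
      = (f - (\<Sum>b\<in>B. \<rho> (c b) * b)) + (g - (\<Sum>b\<in>B. \<rho> (d b) * b))"
    by (simp add: \<rho>_add distrib_right sum.distrib)
  also have "\<dots> \<in> J" using J cd unfolding submodule_def by blast
  finally show ?thesis unfolding spans_mod_def by (rule exI[of _ "\<lambda>b. c b + d b"])
qed

lemma spans_mod_mult:
  assumes J: "submodule J" and "spans_mod J B f"
  shows "spans_mod J B (\<rho> p * f)"
proof -
  obtain c where c: "f - (\<Sum>b\<in>B. \<rho> (c b) * b) \<in> J"
    using assms unfolding spans_mod_def by blast
  have "\<rho> p * f - (\<Sum>b\<in>B. \<rho> (p * c b) * b) = \<rho> p * (f - (\<Sum>b\<in>B. \<rho> (c b) * b))"
    by (simp add: \<rho>_mult sum_distrib_left right_diff_distrib mult.assoc)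
  also have "\<dots> \<in> J" using J c unfolding submodule_def by blast
  finally show ?thesis unfolding spans_mod_def by (rule exI[of _ "\<lambda>b. p * c b"])
qed

lemma spans_mod_sub: "submodule J \<Longrightarrow> f \<in> J \<Longrightarrow> spans_mod J B f"
  unfolding spans_mod_def by (rule exI[of _ "\<lambda>_. 0"]) (simp add: \<rho>_zero)

text \<open>Submodules of a finitely generated \<open>K[X]\<close>-module are finitely generated, here for submodules of the
  span of \<open>B\<close> modulo \<open>J\<close>. As usual one adds one generator \<open>b\<close> at a time: the coefficients of \<open>b\<close> that
  occur in \<open>M\<close> form an ideal of \<open>K[X]\<close>, which is principal, and an element of \<open>M\<close> that realises the
  generator of this ideal cuts \<open>M\<close> down to a submodule of the span of the other generators.\<close>
lemma submodule_finitely_generated: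
  assumes "finite B" and J: "submodule J"
    and "submodule M" "J \<subseteq> M" "\<And>f. f \<in> M \<Longrightarrow> spans_mod J B f"
  shows "\<exists>G. finite G \<and> G \<subseteq> M \<and> (\<forall>N. submodule N \<and> J \<subseteq> N \<and> G \<subseteq> N \<longrightarrow> M \<subseteq> N)"
  using assms(1,3-)
proof (induction B arbitrary: M rule: finite_induct)
  case empty
  then have "M \<subseteq> J" by (auto simp: spans_mod_def)
  then show ?case by (intro exI[of _ "{}"]) auto
next
  case (insert b B)
  note M = insert.prems(1)
  define L where "L = {p. \<exists>f\<in>M. spans_mod J B (f - \<rho> p * b)}"
  have "\<exists>g. \<forall>p. p \<in> L \<longleftrightarrow> g dvd p"
  proof (rule poly_ideal_principal[of L])
    show "0 \<in> L" using spans_mod_zero[OF J] M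
      unfolding L_def submodule_def by (auto simp: \<rho>_zero intro!: bexI[of _ 0])
  next
    fix p q assume "p \<in> L" "q \<in> L"
    then obtain f f' where f: "f \<in> M" "f' \<in> M" "spans_mod J B (f - \<rho> p * b)"
      "spans_mod J B (f' - \<rho> q * b)" unfolding L_def by blast
    have "spans_mod J B ((f + f') - \<rho> (p + q) * b)"
      using spans_mod_add[OF J f(3,4)] by (simp add: \<rho>_add algebra_simps)
    moreover have "f + f' \<in> M" using f M unfolding submodule_def by blast
    ultimately show "p + q \<in> L" unfolding L_def by blast
  next
    fix p q assume "q \<in> L"
    then obtain f where f: "f \<in> M" "spans_mod J B (f - \<rho> q * b)" unfolding L_def by blast
    have "spans_mod J B (\<rho> p * f - \<rho> (p * q) * b)"
      using spans_mod_mult[OF J f(2), of p] by (simp add: \<rho>_mult algebra_simps)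
    moreover have "\<rho> p * f \<in> M" using f M unfolding submodule_def by blast
    ultimately show "p * q \<in> L" unfolding L_def by blast
  qed
  then obtain g where g: "\<And>p. p \<in> L \<longleftrightarrow> g dvd p" by blast
  from g[of g] obtain f0 where f0: "f0 \<in> M" "spans_mod J B (f0 - \<rho> g * b)"
    unfolding L_def by auto
  define M' where "M' = {f \<in> M. spans_mod J B f}"
  have "submodule M'" using M spans_mod_zero[OF J] spans_mod_add[OF J] spans_mod_mult[OF J]
    unfolding M'_def submodule_def by auto
  moreover have "J \<subseteq> M'" using insert.prems(2) spans_mod_sub[OF J] unfolding M'_def by blast
  moreover have "spans_mod J B f" if "f \<in> M'" for f using that unfolding M'_def by simp
  ultimately have "\<exists>G. finite G \<and> G \<subseteq> M' \<and> (\<forall>N. submodule N \<and> J \<subseteq> N \<and> G \<subseteq> N \<longrightarrow> M' \<subseteq> N)"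
    by (rule insert.IH)
  then obtain G where G: "finite G" "G \<subseteq> M'"
    "\<forall>N. submodule N \<and> J \<subseteq> N \<and> G \<subseteq> N \<longrightarrow> M' \<subseteq> N"
    by (elim exE conjE)
  have "f \<in> N" if N: "submodule N" "J \<subseteq> N" "insert f0 G \<subseteq> N" and f: "f \<in> M" for N f
  proof -
    obtain c where c: "f - (\<Sum>b\<in>insert b B. \<rho> (c b) * b) \<in> J"
      using insert.prems(3)[OF f] unfolding spans_mod_def by blast
    then have cb: "spans_mod J B (f - \<rho> (c b) * b)"
      unfolding spans_mod_def using insert.hyps by (auto simp: algebra_simps intro!: exI[of _ c])
    then have "g dvd c b" using g f unfolding L_def by blast
    then obtain h where h: "c b = h * g" by (metis dvdE mult.commute)
    have "spans_mod J B ((f - \<rho> (c b) * b) + \<rho> (- h) * (f0 - \<rho> g * b))"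
      by (intro spans_mod_add[OF J] spans_mod_mult[OF J] cb f0)
    then have "spans_mod J B (f - \<rho> h * f0)"
      by (simp add: h \<rho>_mult \<rho>_uminus algebra_simps)
    moreover have "f - \<rho> h * f0 \<in> M"
      using submodule_diff[OF M] f f0(1) M unfolding submodule_def by blast
    ultimately have "f - \<rho> h * f0 \<in> M'" unfolding M'_def by blast
    then have "f - \<rho> h * f0 \<in> N" using G(3) N by blast
    moreover have "\<rho> h * f0 \<in> N" using N unfolding submodule_def by blast
    ultimately have "(f - \<rho> h * f0) + \<rho> h * f0 \<in> N" using N(1) unfolding submodule_def by blast
    then show ?thesis by simp
  qed
  with G(1,2) f0(1) show ?case unfolding M'_def by (intro exI[of _ "insert f0 G"]) auto
qed

end

section \<open>Rings that are a polynomial ring modulo nilpotents\<close>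
text \<open>\<open>A\<close> is a quotient \<open>\<pi>\<close> of a \<open>K[X]\<close>-algebra, and \<open>\<epsilon>\<close> induces a retraction of \<open>A\<close> onto \<open>K[X]\<close> with
  nilpotent kernel. So \<open>A\<close> has the prime ideals of \<open>K[X]\<close>, and heights are those of \<open>K[X]\<close>.
  Elements of \<open>A\<close> are handled through representatives \<open>f\<close> with \<open>a = \<pi> f\<close>.\<close>
locale poly_retract = poly_algebra \<rho> + A: cring A
  for \<rho> :: "'k::field poly \<Rightarrow> 'r::comm_ring_1" and A (structure) +
  fixes \<pi> :: "'r \<Rightarrow> 'a" and \<epsilon> :: "'r \<Rightarrow> 'k poly"
  assumes \<pi>_surj: "range \<pi> = carrier A"
    and \<pi>_add: "\<pi> (f + g) = \<pi> f \<oplus> \<pi> g"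
    and \<pi>_mult: "\<pi> (f * g) = \<pi> f \<otimes> \<pi> g"
    and \<pi>_one: "\<pi> 1 = \<one>"
    and \<epsilon>_add: "\<epsilon> (f + g) = \<epsilon> f + \<epsilon> g"
    and \<epsilon>_mult: "\<epsilon> (f * g) = \<epsilon> f * \<epsilon> g"
    and \<epsilon>_\<rho>: "\<epsilon> (\<rho> p) = p"
    and \<pi>_ker: "\<pi> f = \<zero> \<Longrightarrow> \<epsilon> f = 0"
    and nilpotent: "\<epsilon> f = 0 \<Longrightarrow> \<exists>N. \<pi> (f ^ N) = \<zero>"
begin

lemma \<pi>_closed [simp]: "\<pi> f \<in> carrier A"
  using \<pi>_surj by blast

lemma \<pi>_cases: assumes "a \<in> carrier A" obtains f where "a = \<pi> f"
  using assms \<pi>_surj by blast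

lemma \<pi>_zero: "\<pi> 0 = \<zero>"
  using \<pi>_add[of 0 0] by (simp add: A.add.r_cancel_one')

lemma \<pi>_uminus: "\<pi> (- f) = \<ominus> \<pi> f"
proof -
  have "\<pi> (- f) \<oplus> \<pi> f = \<zero>" by (simp add: \<pi>_zero flip: \<pi>_add)
  then show ?thesis by (simp add: A.minus_equality)
qed

lemma \<epsilon>_zero: "\<epsilon> 0 = 0" using \<epsilon>_add[of 0 0] by (metis add_0 add_cancel_right_right)
lemma \<epsilon>_one: "\<epsilon> 1 = 1" using \<epsilon>_\<rho>[of 1] by (simp add: \<rho>_one)
lemma \<epsilon>_uminus: "\<epsilon> (- f) = - \<epsilon> f"
  using \<epsilon>_add[of f "- f"] by (simp add: \<epsilon>_zero add_eq_0_iff2)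
lemma \<epsilon>_diff: "\<epsilon> (f - g) = \<epsilon> f - \<epsilon> g"
  using \<epsilon>_add[of f "- g"] by (simp add: \<epsilon>_uminus)

lemma ideal_\<pi>:
  assumes "ideal I A"
  shows "\<pi> 0 \<in> I" "\<pi> f \<in> I \<Longrightarrow> \<pi> g \<in> I \<Longrightarrow> \<pi> (f + g) \<in> I" "\<pi> f \<in> I \<Longrightarrow> \<pi> (- f) \<in> I"
    "\<pi> f \<in> I \<Longrightarrow> \<pi> (h * f) \<in> I"
proof -
  interpret I: ideal I A by fact
  show "\<pi> 0 \<in> I" by (simp add: \<pi>_zero)
  show "\<pi> f \<in> I \<Longrightarrow> \<pi> g \<in> I \<Longrightarrow> \<pi> (f + g) \<in> I" by (simp add: \<pi>_add)
  show "\<pi> f \<in> I \<Longrightarrow> \<pi> (- f) \<in> I" by (simp add: \<pi>_uminus I.a_inv_closed)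
  show "\<pi> f \<in> I \<Longrightarrow> \<pi> (h * f) \<in> I" by (simp add: \<pi>_mult I.I_l_closed)
qed

lemma submodule_preimage: "ideal I A \<Longrightarrow> submodule {f. \<pi> f \<in> I}"
  using ideal_\<pi>[of I] unfolding submodule_def by auto

text \<open>Ideals of \<open>A\<close> are in particular \<open>K[X]\<close>-submodules, and a finite set that generates one as a module
  generates it as an ideal.\<close>
lemma noetherian_if_spanned:
  assumes "finite B" and span: "\<And>f. spans_mod {f. \<pi> f = \<zero>} B f"
  shows "noetherian_ring A"
proof (unfold_locales)
  fix I assume I: "ideal I A"
  then interpret I: ideal I A .
  have J: "submodule {f. \<pi> f = \<zero>}"
    using submodule_preimage[OF A.zeroideal] by simp
  have "{f. \<pi> f = \<zero>} \<subseteq> {f. \<pi> f \<in> I}" by auto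
  from submodule_finitely_generated[OF \<open>finite B\<close> J submodule_preimage[OF I] this span]
  obtain G where G: "finite G" "G \<subseteq> {f. \<pi> f \<in> I}"
    "\<forall>N. submodule N \<and> {f. \<pi> f = \<zero>} \<subseteq> N \<and> G \<subseteq> N \<longrightarrow> {f. \<pi> f \<in> I} \<subseteq> N"
    by (elim exE conjE)
  let ?K = "Idl (\<pi> ` G)"
  have K: "ideal ?K A" by (rule A.genideal_ideal) auto
  then interpret K: ideal ?K A .
  have "\<pi> ` G \<subseteq> carrier A" by auto
  then have "G \<subseteq> {f. \<pi> f \<in> ?K}" using A.genideal_self by blast
  then have "{f. \<pi> f \<in> I} \<subseteq> {f. \<pi> f \<in> ?K}"
    by (intro G(3)[rule_format] conjI submodule_preimage[OF K]) (auto simp: K.zero_closed)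
  then have "I \<subseteq> ?K" using I.a_subset \<pi>_cases by blast
  moreover have "?K \<subseteq> I" using G(2) by (intro A.genideal_minimal[OF I]) auto
  ultimately show "\<exists>A' \<subseteq> carrier A. finite A' \<and> I = Idl A'"
    using G(1) by (intro exI[of _ "\<pi> ` G"]) auto
qed

text \<open>If \<open>d\<close> divides \<open>f\<close> modulo nilpotents, then \<open>f = d e + v\<close> with \<open>v\<close> nilpotent, and \<open>f\<^sup>M\<close> is congruent to
  \<open>v\<^sup>M = 0\<close> modulo \<open>d\<close> for large \<open>M\<close>.\<close>
lemma power_divisible:
  assumes "\<epsilon> f = \<epsilon> (d * e)"
  shows "\<exists>M c. \<pi> (f ^ M) = \<pi> (d * c)"
proof -
  let ?v = "f - d * e"
  have "\<epsilon> ?v = 0" using assms by (simp add: \<epsilon>_diff)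
  then obtain M where M: "\<pi> (?v ^ M) = \<zero>" using nilpotent by blast
  have "\<exists>c. f ^ k = ?v ^ k + d * c" for k
  proof (induction k)
    case 0
    show ?case by (rule exI[of _ 0]) simp
  next
    case (Suc k)
    then obtain c where c: "f ^ k = ?v ^ k + d * c" by blast
    have "f ^ Suc k = ?v * f ^ k + d * (e * f ^ k)" by (simp add: algebra_simps)
    also have "\<dots> = ?v ^ Suc k + d * (?v * c + e * f ^ k)"
      by (subst c) (simp add: algebra_simps)
    finally show ?case by blast
  qed
  then obtain c where "f ^ M = ?v ^ M + d * c" by blast
  then have "\<pi> (f ^ M) = \<pi> (d * c)" by (simp add: \<pi>_add M)
  then show ?thesis by blast
qed

lemma primeideal_power:
  assumes "primeideal Q A" "\<pi> (f ^ N) \<in> Q" shows "\<pi> f \<in> Q"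
proof -
  interpret primeideal Q A by fact
  show ?thesis using assms(2)
  proof (induction N)
    case 0
    then show ?case using I_notcarr one_imp_carrier by (simp add: \<pi>_one)
  next
    case (Suc N)
    then show ?case using I_prime[of "\<pi> f" "\<pi> (f ^ N)"] by (auto simp: \<pi>_mult)
  qed
qed

text \<open>The class of \<open>f - \<rho> (\<epsilon> f)\<close> is nilpotent, so every prime ideal contains it.\<close>
lemma primeideal_trace:
  assumes Q: "primeideal Q A"
  shows "\<pi> f \<in> Q \<longleftrightarrow> \<pi> (\<rho> (\<epsilon> f)) \<in> Q"
proof -
  interpret primeideal Q A by fact
  have I: "ideal Q A" ..
  have nil: "\<pi> g \<in> Q" if "\<epsilon> g = 0" for g
    using nilpotent[OF that] primeideal_power[OF Q] by (metis additive_subgroup.zero_closed ideal.axioms(1) I)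
  have diff: "\<pi> (f - \<rho> (\<epsilon> f)) \<in> Q" by (rule nil) (simp add: \<epsilon>_diff \<epsilon>_\<rho>)
  show ?thesis
    using ideal_\<pi>(2)[OF I diff, of "\<rho> (\<epsilon> f)"]
      ideal_\<pi>(2)[OF I _ ideal_\<pi>(3)[OF I diff], of f]
    by auto
qed

lemma primeideal_generator:
  assumes Q: "primeideal Q A"
  obtains g where "\<not> is_unit g" "\<And>f. \<pi> f \<in> Q \<longleftrightarrow> g dvd \<epsilon> f"
proof -
  interpret primeideal Q A by fact
  have I: "ideal Q A" ..
  obtain g where g: "\<And>p. p \<in> {p. \<pi> (\<rho> p) \<in> Q} \<longleftrightarrow> g dvd p"
    using poly_ideal_principal[of "{p. \<pi> (\<rho> p) \<in> Q}"] ideal_\<pi>[OF I]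
    by (auto simp: \<rho>_add \<rho>_mult \<rho>_zero)
  have "\<pi> f \<in> Q \<longleftrightarrow> g dvd \<epsilon> f" for f
    using primeideal_trace[OF Q] g by blast
  moreover have "\<not> is_unit g"
    using g[of 1] I_notcarr one_imp_carrier by (auto simp: \<rho>_one \<pi>_one)
  ultimately show ?thesis using that by blast
qed

text \<open>The preimage in \<open>A\<close> of the ideal of \<open>K[X]\<close> that \<open>g\<close> generates. For \<open>g = 0\<close> this is the nilradical.\<close>
definition pullback :: "'k poly \<Rightarrow> 'a set" where
  "pullback g = \<pi> ` {f. g dvd \<epsilon> f}"

lemma mem_pullback: "\<pi> f \<in> pullback g \<longleftrightarrow> g dvd \<epsilon> f"
proof
  assume "\<pi> f \<in> pullback g"
  then obtain f' where f': "\<pi> f = \<pi> f'" "g dvd \<epsilon> f'" unfolding pullback_def by auto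
  then have "\<pi> (f - f') = \<zero>"
    using \<pi>_add[of f "- f'"] by (simp add: \<pi>_uminus A.r_neg)
  then have "\<epsilon> f = \<epsilon> f'" using \<pi>_ker by (force simp: \<epsilon>_diff)
  with f' show "g dvd \<epsilon> f" by simp
qed (auto simp: pullback_def)

lemma ideal_pullback: "ideal (pullback g) A"
proof (rule idealI)
  show "ring A" ..
  show "subgroup (pullback g) (add_monoid A)"
  proof (rule A.add.subgroupI)
    show "pullback g \<subseteq> carrier A" by (auto simp: pullback_def)
    show "pullback g \<noteq> {}" using mem_pullback[of 0 g] by (auto simp: \<epsilon>_zero)
  next
    fix a assume "a \<in> pullback g"
    then obtain f where "a = \<pi> f" "g dvd \<epsilon> f" unfolding pullback_def by blast
    then show "\<ominus> a \<in> pullback g"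
      by (simp add: mem_pullback \<epsilon>_uminus flip: \<pi>_uminus)
  next
    fix a b assume "a \<in> pullback g" "b \<in> pullback g"
    then obtain f f' where "a = \<pi> f" "g dvd \<epsilon> f" "b = \<pi> f'" "g dvd \<epsilon> f'"
      unfolding pullback_def by blast
    then show "a \<oplus> b \<in> pullback g"
      by (simp add: mem_pullback \<epsilon>_add flip: \<pi>_add)
  qed
  show l: "x \<otimes> a \<in> pullback g" if ax: "a \<in> pullback g" "x \<in> carrier A" for a x
  proof -
    obtain f h where "a = \<pi> f" "g dvd \<epsilon> f" "x = \<pi> h"
      using ax \<pi>_cases unfolding pullback_def by blast
    then show ?thesis by (simp add: mem_pullback \<epsilon>_mult flip: \<pi>_mult)
  qed
  show "a \<otimes> x \<in> pullback g" if ax: "a \<in> pullback g" "x \<in> carrier A" for a x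
    using l[OF ax] ax by (metis A.m_comm \<pi>_closed pullback_def imageE)
qed

lemma pullback_proper: "\<not> is_unit g \<Longrightarrow> carrier A \<noteq> pullback g"
  by (metis mem_pullback \<pi>_closed \<epsilon>_one)

lemma primeideal_pullback_0: "primeideal (pullback 0) A"
proof (rule primeidealI[OF ideal_pullback])
  show "cring A" ..
  show "carrier A \<noteq> pullback 0" by (rule pullback_proper) simp
  fix a b assume ab: "a \<in> carrier A" "b \<in> carrier A" "a \<otimes> b \<in> pullback 0"
  obtain f g where fg: "a = \<pi> f" "b = \<pi> g" using ab(1,2) \<pi>_cases by metis
  have "\<pi> (f * g) \<in> pullback 0" using ab(3) by (simp add: fg \<pi>_mult)
  then have "\<epsilon> (f * g) = 0" unfolding mem_pullback by simp
  then show "a \<in> pullback 0 \<or> b \<in> pullback 0" by (simp add: fg mem_pullback \<epsilon>_mult)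
qed

lemma maximalideal_pullback_X: "maximalideal (pullback [:0, 1:]) A"
proof (rule maximalidealI[OF ideal_pullback])
  show "carrier A \<noteq> pullback [:0, 1:]" by (rule pullback_proper) (simp add: is_unit_poly_iff)
  fix I assume I: "ideal I A" "pullback [:0, 1:] \<subseteq> I" "I \<subseteq> carrier A"
  interpret I: ideal I A by fact
  show "I = pullback [:0, 1:] \<or> I = carrier A"
  proof (cases "I \<subseteq> pullback [:0, 1:]")
    case False
    then obtain f where f: "\<pi> f \<in> I" "\<not> [:0, 1:] dvd \<epsilon> f"
      using I(3) \<pi>_cases mem_pullback by (metis subsetD subsetI)
    define c where "c = coeff (\<epsilon> f) 0"
    have "c \<noteq> 0" using f(2) by (simp add: c_def dvd_iff_poly_eq_0 poly_0_coeff_0)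
    have "[:0, 1:] dvd \<epsilon> (f - \<rho> [:c:])"
      by (simp add: \<epsilon>_diff \<epsilon>_\<rho> dvd_iff_poly_eq_0 poly_0_coeff_0 c_def)
    then have "\<pi> (f - \<rho> [:c:]) \<in> I" using I(2) mem_pullback by blast
    from ideal_\<pi>(2)[OF I(1) f(1) ideal_\<pi>(3)[OF I(1) this]]
    have "\<pi> (\<rho> [:c:]) \<in> I" by simp
    then have "\<pi> (\<rho> [:inverse c:] * \<rho> [:c:]) \<in> I" by (rule ideal_\<pi>(4)[OF I(1)])
    also have "\<rho> [:inverse c:] * \<rho> [:c:] = 1"
      using \<open>c \<noteq> 0\<close> \<rho>_one by (simp add: one_pCons flip: \<rho>_mult)
    finally show ?thesis using I.one_imp_carrier by (simp add: \<pi>_one)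
  qed (use I in auto)
qed

text \<open>The nilradical lies in every maximal ideal, and it is not maximal itself because it lies properly
  in the preimage of \<open>(X)\<close>.\<close>
lemma pullback_0_psubset:
  assumes P: "maximalideal P A"
  shows "pullback 0 \<subset> P"
proof -
  have prime: "primeideal P A" using P by (rule A.maximalideal_prime)
  interpret maximalideal P A by fact
  obtain g where g: "\<not> is_unit g" "\<And>f. \<pi> f \<in> P \<longleftrightarrow> g dvd \<epsilon> f"
    using primeideal_generator[OF prime] by blast
  have "pullback 0 \<subseteq> P" by (auto simp: pullback_def g(2))
  moreover have "pullback 0 \<noteq> P"
  proof
    assume eq: "pullback 0 = P"
    have sub: "P \<subseteq> pullback [:0, 1:]" by (auto simp flip: eq simp: pullback_def)
    have "pullback [:0, 1:] \<subseteq> carrier A" "carrier A \<noteq> pullback [:0, 1:]"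
      using maximalideal.I_notcarr[OF maximalideal_pullback_X] by (auto simp: pullback_def)
    then have "pullback [:0, 1:] = pullback 0"
      using I_maximal[OF ideal_pullback sub] eq by blast
    then have "[:0, 1:] dvd (\<epsilon> (\<rho> [:0, 1:])) \<longleftrightarrow> 0 dvd \<epsilon> (\<rho> [:0, 1:])"
      by (metis mem_pullback)
    then show False by (simp add: \<epsilon>_\<rho>)
  qed
  ultimately show ?thesis by blast
qed

text \<open>In a chain of three primes the generators \<open>g1 \<noteq> 0\<close> and \<open>g2\<close> of the upper two would satisfy
  \<open>g1 = g2 h\<close>; as \<open>g1\<close> is prime it divides \<open>g2\<close> or \<open>h\<close>, so the two ideals agree or \<open>g2\<close> is a unit.\<close>
lemma prime_chain_length_le_1:
  assumes prime: "\<And>i. i \<le> k \<Longrightarrow> primeideal (Q i) A"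
    and chain: "\<And>i. i < k \<Longrightarrow> Q i \<subset> Q (Suc i)"
  shows "k \<le> (1 :: nat)"
proof (rule ccontr)
  assume "\<not> k \<le> 1"
  then have k: "0 \<le> k" "1 \<le> k" "2 \<le> k" "0 < k" "1 < k" by auto
  have sub: "Q 0 \<subset> Q 1" "Q 1 \<subset> Q 2"
    using chain[OF k(4)] chain[OF k(5)] by (simp_all add: numeral_2_eq_2)
  obtain g1 where g1: "\<And>f. \<pi> f \<in> Q 1 \<longleftrightarrow> g1 dvd \<epsilon> f"
    using primeideal_generator[OF prime[OF k(2)]] by metis
  obtain g2 where g2: "\<not> is_unit g2" "\<And>f. \<pi> f \<in> Q 2 \<longleftrightarrow> g2 dvd \<epsilon> f"
    using primeideal_generator[OF prime[OF k(3)]] by metis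
  obtain g0 where g0: "\<And>f. \<pi> f \<in> Q 0 \<longleftrightarrow> g0 dvd \<epsilon> f"
    using primeideal_generator[OF prime[OF k(1)]] by metis
  have carr: "Q i \<subseteq> carrier A" if "i \<le> k" for i
    using prime[OF that] by (meson additive_subgroup.a_subset ideal_def primeideal_def)
  have "g1 \<noteq> 0"
    using sub(1) carr[OF k(2)] g0 g1 \<pi>_cases by (metis dvd_0_left dvd_0_right psubsetE subset_eq)
  have "g2 dvd g1" using sub(2) g1[of "\<rho> g1"] g2(2)[of "\<rho> g1"] by (auto simp: \<epsilon>_\<rho>)
  then obtain h where h: "g1 = g2 * h" by blast
  interpret Q: primeideal "Q 1" A using prime k by blast
  have "\<pi> (\<rho> g2) \<otimes> \<pi> (\<rho> h) \<in> Q 1"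
    unfolding \<pi>_mult[symmetric] \<rho>_mult[symmetric] g1 \<epsilon>_\<rho> h by simp
  then consider "g1 dvd g2" | "g1 dvd h"
    using Q.I_prime[of "\<pi> (\<rho> g2)" "\<pi> (\<rho> h)"] g1 by (auto simp: \<epsilon>_\<rho>)
  then show False
  proof cases
    case 1
    then have "Q 2 \<subseteq> Q 1"
      using carr[OF k(3)] g1 g2(2) \<pi>_cases by (metis dvd_trans subset_eq)
    with sub show False by blast
  next
    case 2
    then obtain l where "h = g1 * l" by blast
    with h have "g1 * 1 = g1 * (g2 * l)" by (simp add: ac_simps)
    then have "g2 * l = 1" using \<open>g1 \<noteq> 0\<close> by (metis mult_cancel_left)
    with g2(1) show False by (metis dvd_triv_left)
  qed
qed

lemma prime_height_maximal:
  assumes P: "maximalideal P A"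
  shows "prime_height A P = 1"
proof (rule antisym)
  show "prime_height A P \<le> 1"
    unfolding prime_height_def using prime_chain_length_le_1
    by (intro SUP_least) (auto simp: one_enat_def)
  show "1 \<le> prime_height A P"
    unfolding prime_height_def one_enat_def
  proof (rule SUP_upper, intro CollectI exI conjI)
    let ?Q = "\<lambda>i :: nat. if i = 0 then pullback 0 else P"
    show "\<forall>i\<le>1. primeideal (?Q i) A"
      using primeideal_pullback_0 A.maximalideal_prime[OF P] by auto
    show "\<forall>i<1. ?Q i \<subset> ?Q (Suc i)" using pullback_0_psubset[OF P] by auto
  qed auto
qed

definition nonzerodivisor :: "'r \<Rightarrow> bool" where
  "nonzerodivisor f \<longleftrightarrow> (\<forall>b. \<pi> (f * b) = \<zero> \<longrightarrow> \<pi> b = \<zero>)"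

lemma Idl_empty: "Idl {} = {\<zero>}"
proof
  show "Idl {} \<subseteq> {\<zero>}" by (rule A.genideal_minimal[OF A.zeroideal]) simp
  interpret ideal "Idl {}" A by (rule A.genideal_ideal) simp
  show "{\<zero>} \<subseteq> Idl {}" by simp
qed

lemma mem_Idl_singleton: "\<pi> b \<in> Idl {\<pi> f} \<longleftrightarrow> (\<exists>h. \<pi> b = \<pi> (h * f))"
  unfolding A.cgenideal_eq_genideal[OF \<pi>_closed, symmetric] cgenideal_def
    mem_Collect_eq \<pi>_mult
  by (metis \<pi>_cases \<pi>_closed)

lemma regular_sequence_singleton:
  assumes "ideal P A" "carrier A \<noteq> P" "\<pi> f \<in> P" "nonzerodivisor f"
  shows "regular_sequence A [\<pi> f]"
proof -
  have "Idl {\<pi> f} \<subseteq> P" by (rule A.genideal_minimal) (use assms in auto)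
  moreover have "P \<subseteq> carrier A" using assms(1) by (meson additive_subgroup.a_subset ideal_def)
  ultimately have "Idl {\<pi> f} \<noteq> carrier A" using assms(2) by blast
  moreover have "b = \<zero>" if b: "b \<in> carrier A" "\<pi> f \<otimes> b = \<zero>" for b
    using b assms(4) \<pi>_cases[OF b(1)] unfolding nonzerodivisor_def by (metis \<pi>_mult)
  ultimately show ?thesis unfolding regular_sequence_def by (auto simp: Idl_empty)
qed

lemma regular_sequence_hd:
  assumes "regular_sequence A (\<pi> f # as)"
  shows "nonzerodivisor f"
  using assms unfolding regular_sequence_def nonzerodivisor_def
  by (auto simp: Idl_empty \<pi>_mult dest!: spec[of _ 0])

text \<open>Let \<open>\<pi> f1, \<pi> f2\<close> be the start of a longer regular sequence in \<open>P\<close>, and let \<open>g\<close> generate the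
  trace of \<open>P\<close> on \<open>K[X]\<close>. As \<open>f1\<close> is not nilpotent, some \<open>s \<noteq> 0\<close> in \<open>K[X]\<close> lies in the ideal of \<open>f1\<close>.
  It lies in \<open>P\<close>, so \<open>s = g s'\<close>, and a power of \<open>f2\<close> is a multiple of \<open>g\<close>, so that this power times \<open>s'\<close>
  is a multiple of \<open>s\<close>. Cancelling the power modulo \<open>f1\<close> leaves \<open>s'\<close> in the ideal of \<open>f1\<close>, and
  this descent in the degree does not end.\<close>
lemma regular_sequence_length_le_1:
  assumes P: "maximalideal P A" and reg: "regular_sequence A as" and "set as \<subseteq> P"
  shows "length as \<le> 1"
proof (rule ccontr)
  assume "\<not> length as \<le> 1"
  then obtain a1 a2 as' where as: "as = a1 # a2 # as'"
    by (metis One_nat_def Suc_le_mono le0 length_Cons list.size(3) neq_Nil_conv order_refl)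
  have prime: "primeideal P A" using P by (rule A.maximalideal_prime)
  have "a1 \<in> carrier A" "a2 \<in> carrier A" using reg as unfolding regular_sequence_def by auto
  then obtain f1 f2 where f: "a1 = \<pi> f1" "a2 = \<pi> f2" using \<pi>_cases by metis
  obtain g where g: "\<not> is_unit g" "\<And>f. \<pi> f \<in> P \<longleftrightarrow> g dvd \<epsilon> f"
    using primeideal_generator[OF prime] by metis
  have f1: "nonzerodivisor f1" using regular_sequence_hd reg as f by blast
  have f2: "\<pi> b \<in> Idl {\<pi> f1}" if "\<pi> (f2 * b) \<in> Idl {\<pi> f1}" for b
    using reg that unfolding regular_sequence_def as f
    by (auto simp: \<pi>_mult dest!: spec[of _ 1])
  have f2_power: "\<pi> b \<in> Idl {\<pi> f1}" if "\<pi> (f2 ^ k * b) \<in> Idl {\<pi> f1}" for b k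
    using that by (induction k) (auto simp: mult.assoc dest: f2)
  have gf: "g dvd \<epsilon> f1" "g dvd \<epsilon> f2" using assms(3) g(2) by (auto simp: as f)
  have no: "\<epsilon> f1 \<noteq> 0"
  proof
    assume "\<epsilon> f1 = 0"
    then obtain N where "\<pi> (f1 ^ N) = \<zero>" using nilpotent by blast
    then have "\<pi> 1 = \<zero>"
      using f1 unfolding nonzerodivisor_def by (induction N) auto
    then show False using \<pi>_ker[of 1] by (simp add: \<epsilon>_one)
  qed
  have I: "ideal (Idl {\<pi> f1}) A" by (rule A.genideal_ideal) simp
  have Isub: "Idl {\<pi> f1} \<subseteq> P"
    by (rule A.genideal_minimal) (use P assms(3) in \<open>auto simp: as f maximalideal_def\<close>)
  have *: False if "s \<noteq> 0" "\<pi> (\<rho> s) \<in> Idl {\<pi> f1}" for s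
    using that
  proof (induction "degree s" arbitrary: s rule: less_induct)
    case (less s)
    have "g dvd s" using less.prems(2) Isub g(2)[of "\<rho> s"] by (auto simp: \<epsilon>_\<rho>)
    then obtain s' where s': "s = g * s'" by blast
    then have nz: "g \<noteq> 0" "s' \<noteq> 0" using less.prems(1) by auto
    then have "degree g \<noteq> 0" using g(1) by (simp add: is_unit_iff_degree)
    then have deg: "degree s' < degree s" using nz by (simp add: s' degree_mult_eq)
    obtain h where "\<epsilon> f2 = g * h" using gf(2) by blast
    then have "\<epsilon> f2 = \<epsilon> (\<rho> g * \<rho> h)" by (simp add: \<epsilon>_mult \<epsilon>_\<rho>)
    then obtain M c where M: "\<pi> (f2 ^ M) = \<pi> (\<rho> g * c)" using power_divisible by blast
    have "\<pi> (f2 ^ M * \<rho> s') = \<pi> (f2 ^ M) \<otimes> \<pi> (\<rho> s')" by (simp add: \<pi>_mult)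
    also have "\<dots> = \<pi> (c * \<rho> s)" unfolding M \<pi>_mult[symmetric] by (simp add: s' \<rho>_mult ac_simps)
    also have "\<dots> \<in> Idl {\<pi> f1}" by (rule ideal_\<pi>(4)[OF I less.prems(2)])
    finally have "\<pi> (\<rho> s') \<in> Idl {\<pi> f1}" by (rule f2_power)
    with less.hyps[OF deg nz(2)] show False by blast
  qed
  have "\<epsilon> (\<rho> (\<epsilon> f1)) = \<epsilon> (f1 * 1)" by (simp add: \<epsilon>_\<rho>)
  then obtain M c where "\<pi> (\<rho> (\<epsilon> f1) ^ M) = \<pi> (f1 * c)" using power_divisible by blast
  then have "\<pi> (\<rho> (\<epsilon> f1 ^ M)) \<in> Idl {\<pi> f1}"
    unfolding mem_Idl_singleton by (auto simp: \<rho>_power mult.commute)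
  with *[of "\<epsilon> f1 ^ M"] no show False by simp
qed

lemma ideal_depth_maximal:
  assumes P: "maximalideal P A"
  shows "ideal_depth A P = 1 \<longleftrightarrow> (\<exists>f. \<pi> f \<in> P \<and> nonzerodivisor f)"
proof
  interpret maximalideal P A by fact
  have P': "ideal P A" ..
  let ?S = "{as. regular_sequence A as \<and> set as \<subseteq> P}"
  show "\<exists>f. \<pi> f \<in> P \<and> nonzerodivisor f" if "ideal_depth A P = 1"
  proof (rule ccontr)
    assume no: "\<nexists>f. \<pi> f \<in> P \<and> nonzerodivisor f"
    have "as = []" if "as \<in> ?S" for as
    proof (cases as)
      case (Cons a as')
      with that obtain f where "a = \<pi> f" using a_subset \<pi>_cases by auto
      then show ?thesis using that Cons no regular_sequence_hd by auto
    qed simp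
    then have "ideal_depth A P \<le> 0" unfolding ideal_depth_def
      by (intro SUP_least) (auto simp: zero_enat_def)
    with that show False by simp
  qed
  show "ideal_depth A P = 1" if ex: "\<exists>f. \<pi> f \<in> P \<and> nonzerodivisor f"
  proof (rule antisym)
    show "ideal_depth A P \<le> 1" unfolding ideal_depth_def
      using regular_sequence_length_le_1[OF P]
      by (intro SUP_least) (auto simp: one_enat_def)
    obtain f where f: "\<pi> f \<in> P" "nonzerodivisor f" using ex by blast
    then have "[\<pi> f] \<in> ?S" using regular_sequence_singleton[OF P' I_notcarr] by simp
    then have "enat (length [\<pi> f]) \<le> ideal_depth A P"
      unfolding ideal_depth_def by (rule SUP_upper)
    then show "1 \<le> ideal_depth A P" by (simp add: one_enat_def)
  qed
qed

text \<open>At the maximal ideal over \<open>(X)\<close> depth 1 provides a nonzerodivisor \<open>f\<close>, and \<open>X\<close> divides a power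
  of \<open>f\<close>.\<close>
theorem cohen_macaulay_imp_nonzerodivisor:
  assumes "cohen_macaulay A"
  shows "nonzerodivisor (\<rho> [:0, 1:])"
proof -
  let ?X = "[:0, 1:] :: 'k poly"
  have "ideal_depth A (pullback ?X) = 1"
    using assms maximalideal_pullback_X prime_height_maximal[OF maximalideal_pullback_X]
    unfolding cohen_macaulay_def by metis
  then obtain f where f: "?X dvd \<epsilon> f" "nonzerodivisor f"
    using ideal_depth_maximal[OF maximalideal_pullback_X] mem_pullback by blast
  then obtain h where "\<epsilon> f = ?X * h" by blast
  then have "\<epsilon> f = \<epsilon> (\<rho> ?X * \<rho> h)" by (simp only: \<epsilon>_mult \<epsilon>_\<rho>)
  then obtain M c where M: "\<pi> (f ^ M) = \<pi> (\<rho> ?X * c)" using power_divisible by blast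
  have cancel: "\<pi> b = \<zero>" if "\<pi> (f ^ k * b) = \<zero>" for k b
    using that f(2) by (induction k) (auto simp: nonzerodivisor_def mult.assoc)
  show ?thesis unfolding nonzerodivisor_def
  proof (intro allI impI)
    fix b assume b: "\<pi> (\<rho> ?X * b) = \<zero>"
    have "\<pi> (f ^ M * b) = \<pi> (\<rho> ?X * c) \<otimes> \<pi> b" by (simp add: \<pi>_mult M)
    also have "\<dots> = \<pi> c \<otimes> \<pi> (\<rho> ?X * b)" by (simp only: \<pi>_mult[symmetric]) (simp add: ac_simps)
    also have "\<dots> = \<zero>" by (simp add: b)
    finally show "\<pi> b = \<zero>" by (rule cancel)
  qed
qed

text \<open>A maximal ideal is larger than the nilradical, so it contains a nonzero polynomial in \<open>X\<close>.\<close>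
theorem cohen_macaulay_if_torsion_free:
  assumes "noetherian_ring A"
    and tf: "\<And>p. p \<noteq> 0 \<Longrightarrow> nonzerodivisor (\<rho> p)"
  shows "cohen_macaulay A"
proof -
  have "ideal_depth A P = prime_height A P" if P: "maximalideal P A" for P
  proof -
    obtain a where a: "a \<in> P" "a \<notin> pullback 0" using pullback_0_psubset[OF P] by blast
    interpret maximalideal P A by fact
    obtain f where f: "a = \<pi> f" using a(1) a_subset \<pi>_cases by auto
    then have "\<pi> (\<rho> (\<epsilon> f)) \<in> P" "\<epsilon> f \<noteq> 0"
      using a primeideal_trace[OF A.maximalideal_prime[OF P]] by (auto simp: mem_pullback)
    then show ?thesis
      using tf ideal_depth_maximal[OF P] prime_height_maximal[OF P] by auto
  qed
  then show ?thesis using assms(1) A.is_cring unfolding cohen_macaulay_def by blast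
qed

end

section \<open>Monomials, their weights, and ideals of polynomials\<close>
definition mdeg :: "('x::finite \<Rightarrow>\<^sub>0 nat) \<Rightarrow> nat" where
  "mdeg m = (\<Sum>i\<in>UNIV. Poly_Mapping.lookup m i)"

definition weight :: "('x::finite \<Rightarrow> nat) \<Rightarrow> ('x \<Rightarrow>\<^sub>0 nat) \<Rightarrow> nat" where
  "weight n m = (\<Sum>i\<in>UNIV. n i * Poly_Mapping.lookup m i)"

lemma mdeg_add: "mdeg (m + k) = mdeg m + mdeg k"
  by (simp add: mdeg_def lookup_add sum.distrib)

lemma weight_add: "weight n (m + k) = weight n m + weight n k"
  by (simp add: weight_def lookup_add distrib_left sum.distrib)

lemma mdeg_single [simp]: "mdeg (Poly_Mapping.single i k) = k"
  by (simp add: mdeg_def lookup_single when_def)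

lemma weight_single [simp]: "weight n (Poly_Mapping.single i k) = n i * k"
  by (simp add: weight_def lookup_single when_def if_distrib cong: if_cong)

text \<open>The linear map with \<open>x\<^sup>m \<mapsto> t\<close> to the power \<open>w m\<close> if \<open>P m\<close>, and \<open>x\<^sup>m \<mapsto> 0\<close> otherwise. Besides the
  parametrisation of the curve it covers three maps used below: the projection to the tangent cone,
  the restriction to a coordinate axis, and the sum of the coefficients over a set of
  monomials.\<close>
definition weighted_part ::
    "(('x \<Rightarrow>\<^sub>0 nat) \<Rightarrow> bool) \<Rightarrow> (('x \<Rightarrow>\<^sub>0 nat) \<Rightarrow> nat) \<Rightarrow> ('x, 'k::comm_ring_1) mpoly \<Rightarrow> 'k poly" where
  "weighted_part P w f =
     (\<Sum>m \<in> Poly_Mapping.keys f. if P m then Polynomial.monom (Poly_Mapping.lookup f m) (w m) else 0)"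

lemma weighted_part_superset:
  assumes "finite A" and "Poly_Mapping.keys f \<subseteq> A"
  shows "weighted_part P w f =
    (\<Sum>m\<in>A. if P m then Polynomial.monom (Poly_Mapping.lookup f m) (w m) else 0)"
  unfolding weighted_part_def
  by (rule sum.mono_neutral_left) (use assms in \<open>auto simp: in_keys_iff\<close>)

lemma weighted_part_single:
  "weighted_part P w (Poly_Mapping.single m c) = (if P m then Polynomial.monom c (w m) else 0)"
  by (cases "c = 0") (simp_all add: weighted_part_def)

lemma weighted_part_zero [simp]: "weighted_part P w 0 = 0"
  by (simp add: weighted_part_def)

lemma weighted_part_add: "weighted_part P w (f + g) = weighted_part P w f + weighted_part P w g"
proof -
  let ?A = "Poly_Mapping.keys f \<union> Poly_Mapping.keys g"
  have "weighted_part P w h =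
      (\<Sum>m\<in>?A. if P m then Polynomial.monom (Poly_Mapping.lookup h m) (w m) else 0)"
    if "Poly_Mapping.keys h \<subseteq> ?A" for h
    using that by (intro weighted_part_superset) auto
  from this[OF Poly_Mapping.keys_add] this[of f] this[of g] show ?thesis
    by (auto simp: lookup_add add_monom intro!: sum.cong simp flip: sum.distrib)
qed

lemma weighted_part_uminus: "weighted_part P w (- f) = - weighted_part P w f"
  using weighted_part_add[of P w f "- f"] by (simp add: add_eq_0_iff2)

lemma weighted_part_diff: "weighted_part P w (f - g) = weighted_part P w f - weighted_part P w g"
  using weighted_part_add[of P w f "- g"] by (simp add: weighted_part_uminus)

lemma coeff_weighted_part:
  "coeff (weighted_part P w f) s =
     (\<Sum>m \<in> {m \<in> Poly_Mapping.keys f. P m \<and> w m = s}. Poly_Mapping.lookup f m)"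
  unfolding weighted_part_def coeff_sum
  by (auto simp: sum.inter_filter intro!: sum.cong)

lemma curve_map_eq_weighted_part: "curve_map n = weighted_part (\<lambda>_. True) (weight n)"
  by (rule ext) (simp add: curve_map_def weighted_part_def weight_def)

lemma single_diff_in_curve_ideal:
  "Poly_Mapping.single m 1 - Poly_Mapping.single m' 1 \<in> (curve_ideal n :: ('x::finite, 'k::field) mpoly set)
     \<longleftrightarrow> weight n m = weight n m'"
proof -
  have "Polynomial.monom (1::'k) a = Polynomial.monom 1 b \<longleftrightarrow> a = b" for a b
    by (metis degree_monom_eq one_neq_zero)
  then show ?thesis
    by (simp add: curve_ideal_def curve_map_eq_weighted_part weighted_part_diff weighted_part_single)
qed

lemma var_power: "var i ^ k = (Poly_Mapping.single (Poly_Mapping.single i k) 1 :: ('x, 'k::comm_ring_1) mpoly)"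
  by (induction k) (simp_all add: var_def mult_single single_add [symmetric])

lemma ideal_mpoly_ringI:
  fixes I :: "('x, 'k::comm_ring_1) mpoly set"
  assumes "0 \<in> I" "\<And>f g. f \<in> I \<Longrightarrow> g \<in> I \<Longrightarrow> f + g \<in> I" "\<And>f g. f \<in> I \<Longrightarrow> g * f \<in> I"
  shows "ideal I mpoly_ring"
proof -
  interpret cring "mpoly_ring :: ('x, 'k) mpoly ring" by (rule cring_mpoly_ring)
  have neg: "\<ominus>\<^bsub>mpoly_ring\<^esub> f = - f" for f :: "('x, 'k) mpoly"
    by (rule minus_equality) (simp_all add: mpoly_ring_def)
  show ?thesis
  proof (rule idealI)
    show "ring (mpoly_ring :: ('x, 'k) mpoly ring)" ..
    show "subgroup I (add_monoid mpoly_ring)"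
    proof (rule add.subgroupI)
      fix f assume "f \<in> I"
      then have "(- 1) * f \<in> I" by (rule assms)
      then show "\<ominus>\<^bsub>mpoly_ring\<^esub> f \<in> I" by (simp add: neg)
    qed (use assms in \<open>auto simp: mpoly_ring_def\<close>)
  qed (use assms in \<open>auto simp: mpoly_ring_def mult.commute\<close>)
qed

lemma ideal_mpoly_ringD:
  fixes I :: "('x, 'k::comm_ring_1) mpoly set"
  assumes "ideal I mpoly_ring"
  shows "0 \<in> I" "f \<in> I \<Longrightarrow> g \<in> I \<Longrightarrow> f + g \<in> I" "f \<in> I \<Longrightarrow> g * f \<in> I"
proof -
  interpret ideal I mpoly_ring by fact
  show "0 \<in> I" using additive_subgroup.zero_closed[OF ideal.axioms(1)[OF assms]] by (simp add: mpoly_ring_def)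
  show "f \<in> I \<Longrightarrow> g \<in> I \<Longrightarrow> f + g \<in> I" using additive_subgroup.a_closed[OF ideal.axioms(1)[OF assms]] by (simp add: mpoly_ring_def)
  show "f \<in> I \<Longrightarrow> g * f \<in> I" using I_l_closed by (simp add: mpoly_ring_def)
qed

lemma ideal_ideal_gen: "ideal (ideal_gen F) (mpoly_ring :: ('x, 'k::comm_ring_1) mpoly ring)"
  using ring.genideal_ideal[OF cring.axioms(1)[OF cring_mpoly_ring]] by (simp add: mpoly_ring_def)

lemma ideal_gen_superset: "F \<subseteq> ideal_gen (F :: ('x, 'k::comm_ring_1) mpoly set)"
  using ring.genideal_self[OF cring.axioms(1)[OF cring_mpoly_ring]] by (simp add: mpoly_ring_def)

lemma ideal_gen_least:
  "ideal I (mpoly_ring :: ('x, 'k::comm_ring_1) mpoly ring) \<Longrightarrow> F \<subseteq> I \<Longrightarrow> ideal_gen F \<subseteq> I"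
  using ring.genideal_minimal[OF cring.axioms(1)[OF cring_mpoly_ring]] by blast

section \<open>The initial ideal of a monomial curve\<close>
definition degree_maximal :: "('x::finite \<Rightarrow> nat) \<Rightarrow> ('x \<Rightarrow>\<^sub>0 nat) \<Rightarrow> bool" where
  "degree_maximal n m \<longleftrightarrow> (\<forall>m'. weight n m' = weight n m \<longrightarrow> mdeg m' \<le> mdeg m)"

lemma degree_maximal_exists:
  assumes pos: "\<And>i. 0 < n i"
  obtains m' where "degree_maximal n m'" "weight n m' = weight n m"
proof -
  have "mdeg m' \<le> weight n m'" for m'
    unfolding mdeg_def weight_def
    by (rule sum_mono) (use pos in \<open>simp add: Suc_leI\<close>)
  then have "\<forall>m'. weight n m' = weight n m \<longrightarrow> mdeg m' \<le> weight n m" by metis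
  then obtain m' where "weight n m' = weight n m"
    "\<forall>y. weight n y = weight n m \<longrightarrow> mdeg y \<le> mdeg m'"
    using ex_has_greatest_nat[of "\<lambda>m'. weight n m' = weight n m" m mdeg "Suc (weight n m)"] by (auto simp: less_Suc_eq_le)
  then show ?thesis using that unfolding degree_maximal_def by metis
qed

lemma degree_maximal_divisor: "degree_maximal n (m + k) \<Longrightarrow> degree_maximal n m"
  unfolding degree_maximal_def
  by (metis mdeg_add weight_add add_le_cancel_right)

text \<open>Whether \<open>m + k\<close> is degree-maximal depends on a degree-maximal \<open>m\<close> only through its weight, because
  this weight determines the degree of \<open>m\<close>.\<close>
lemma degree_maximal_add_cong:
  assumes "degree_maximal n m" "degree_maximal n m'" "weight n m' = weight n m"
  shows "degree_maximal n (m + k) \<longleftrightarrow> degree_maximal n (m' + k)"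
proof -
  have "mdeg m' = mdeg m" using assms unfolding degree_maximal_def by (metis le_antisym)
  with assms(3) show ?thesis unfolding degree_maximal_def by (simp add: mdeg_add weight_add)
qed

text \<open>The associated graded ring of the semigroup ring \<open>K[S]\<close> has the basis \<open>t\<^sup>s\<close>, \<open>s \<in> S\<close>, in which \<open>t\<^sup>s\<close> has as degree
  the largest number of generators with sum \<open>s\<close>, and a product of basis elements is \<open>0\<close> if their
  degrees do not add up. This map is the projection to that ring; its values are written as ordinary
  polynomials, so it is linear but not multiplicative.\<close>
definition leading_image :: "('x::finite \<Rightarrow> nat) \<Rightarrow> ('x, 'k::comm_ring_1) mpoly \<Rightarrow> 'k poly" where
  "leading_image n = weighted_part (degree_maximal n) (weight n)"

lemma leading_image_add: "leading_image n (f + g) = leading_image n f + leading_image n g"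
  by (simp add: leading_image_def weighted_part_add)

text \<open>Multiplication by a monomial acts on the image of \<open>f\<close>: it shifts the coefficients and deletes those at
  weights where the product loses degree-maximality. So the kernel absorbs multiplication.\<close>
lemma coeff_leading_image_mult:
  "coeff (leading_image n (Poly_Mapping.single k c * f)) t =
     (if weight n k \<le> t \<and>
         (\<exists>m. weight n m + weight n k = t \<and> degree_maximal n m \<and> degree_maximal n (m + k))
      then c * coeff (leading_image n f) (t - weight n k) else 0)"
proof (induction f rule: mpoly_additive_induct)
  case (single m d)
  show ?case
  proof (cases "t = weight n m + weight n k")
    case False
    then show ?thesis
      by (auto simp: leading_image_def mult_single weighted_part_single weight_add add.commute)
  next
    case True
    have "degree_maximal n (k + m) \<longleftrightarrow> degree_maximal n m \<and>
        (\<exists>m'. weight n m' = weight n m \<and> degree_maximal n m' \<and> degree_maximal n (m' + k))"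
      using degree_maximal_add_cong degree_maximal_divisor by (metis add.commute)
    then show ?thesis unfolding True
      by (simp add: leading_image_def mult_single weighted_part_single weight_add add.commute) blast
  qed
next
  case (add f g)
  define E where "E \<longleftrightarrow> weight n k \<le> t \<and>
    (\<exists>m. weight n m + weight n k = t \<and> degree_maximal n m \<and> degree_maximal n (m + k))"
  show ?case
    using add.IH[folded E_def] unfolding E_def[symmetric]
    by (cases E) (simp_all add: distrib_left leading_image_add)
qed

lemma ideal_ker_leading_image:
  "ideal {f. leading_image n f = 0} (mpoly_ring :: ('x::finite, 'k::comm_ring_1) mpoly ring)"
proof (rule ideal_mpoly_ringI)
  fix f g :: "('x, 'k) mpoly" assume f: "f \<in> {f. leading_image n f = 0}"
  have "leading_image n (g * f) = 0"
  proof (induction g rule: mpoly_additive_induct)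
    case (single m c)
    show ?case by (rule poly_eqI) (use f in \<open>simp add: coeff_leading_image_mult\<close>)
  next
    case (add g h)
    then show ?case by (simp add: leading_image_def distrib_right weighted_part_add)
  qed
  then show "g * f \<in> {f. leading_image n f = 0}" by simp
qed (auto simp: leading_image_def weighted_part_add)

lemma lookup_homogeneous_component:
  "Poly_Mapping.lookup (homogeneous_component d f) m = (if mdeg m = d then Poly_Mapping.lookup f m else 0)"
proof -
  have "Poly_Mapping.lookup (homogeneous_component d f) m =
    (\<Sum>k\<in>{k \<in> Poly_Mapping.keys f. mdeg k = d}. if k = m then Poly_Mapping.lookup f k else 0)"
    unfolding homogeneous_component_def lookup_sum mdeg_def
    by (intro sum.cong) (auto simp: lookup_single when_def)
  also have "\<dots> = (if mdeg m = d then Poly_Mapping.lookup f m else 0)"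
    by (subst sum.delta) (auto simp: in_keys_iff)
  finally show ?thesis .
qed

lemma initial_form_eqI:
  assumes "h \<noteq> 0" and h: "\<And>m. m \<in> Poly_Mapping.keys h \<Longrightarrow> mdeg m = d"
    and r: "\<And>m. m \<in> Poly_Mapping.keys r \<Longrightarrow> d < mdeg m"
  shows "initial_form (h + r) = h"
proof -
  have *: "homogeneous_component d' (h + r) = (if d' = d then h else 0)" if "d' \<le> d" for d'
  proof (rule poly_mapping_eqI)
    fix m
    have "Poly_Mapping.lookup h m = 0 \<or> mdeg m = d" "Poly_Mapping.lookup r m = 0 \<or> d < mdeg m"
      using h[of m] r[of m] by (auto simp: in_keys_iff)
    then show "Poly_Mapping.lookup (homogeneous_component d' (h + r)) m
        = Poly_Mapping.lookup (if d' = d then h else 0) m"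
      using that by (auto simp: lookup_homogeneous_component lookup_add)
  qed
  have "(LEAST d. homogeneous_component d (h + r) \<noteq> 0) = d"
  proof (rule Least_equality)
    show "homogeneous_component d (h + r) \<noteq> 0" using * assms(1) by simp
    show "d \<le> d'" if "homogeneous_component d' (h + r) \<noteq> 0" for d'
      using that * by (metis le_cases less_irrefl nle_le)
  qed
  then show ?thesis unfolding initial_form_def using * by simp
qed

text \<open>Let \<open>d\<close> be the order of \<open>f\<close>. If a monomial of degree \<open>d\<close> and weight \<open>s\<close> is degree-maximal, then all
  monomials of weight \<open>s\<close> in \<open>f\<close> have degree \<open>d\<close>, so the coefficient at \<open>t\<^sup>s\<close> is the one of the image
  of \<open>f\<close> under the parametrisation, which is \<open>0\<close>.\<close>
lemma leading_image_initial_form: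
  assumes "f \<in> curve_ideal n"
  shows "leading_image n (initial_form f) = 0"
proof (rule poly_eqI)
  fix s
  define d where "d = (LEAST d. homogeneous_component d f \<noteq> 0)"
  have ge: "d \<le> mdeg m" if "m \<in> Poly_Mapping.keys f" for m
  proof -
    have "Poly_Mapping.lookup (homogeneous_component (mdeg m) f) m \<noteq> 0"
      using that by (simp add: lookup_homogeneous_component in_keys_iff)
    then show ?thesis unfolding d_def by (intro Least_le) auto
  qed
  have lookup: "Poly_Mapping.lookup (initial_form f) m = (if mdeg m = d then Poly_Mapping.lookup f m else 0)" for m
    by (simp add: initial_form_def d_def lookup_homogeneous_component)
  have keys: "Poly_Mapping.keys (initial_form f) = {m \<in> Poly_Mapping.keys f. mdeg m = d}"
    by (auto simp: in_keys_iff lookup split: if_splits)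
  let ?S = "{m \<in> Poly_Mapping.keys (initial_form f). degree_maximal n m \<and> weight n m = s}"
  have "(\<Sum>m\<in>?S. Poly_Mapping.lookup (initial_form f) m) = 0"
  proof (cases "?S = {}")
    case False
    then obtain m where m: "mdeg m = d" "degree_maximal n m" "weight n m = s"
      by (auto simp: keys)
    have "mdeg m' = d \<and> degree_maximal n m'" if "m' \<in> Poly_Mapping.keys f" "weight n m' = s" for m'
      using that m ge unfolding degree_maximal_def by (metis le_antisym)
    then have "?S = {m \<in> Poly_Mapping.keys f. weight n m = s}"
      unfolding keys by auto
    then have "(\<Sum>m\<in>?S. Poly_Mapping.lookup (initial_form f) m) = coeff (curve_map n f) s"
      unfolding curve_map_eq_weighted_part coeff_weighted_part
      by (auto simp: lookup keys intro!: sum.cong)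
    also have "\<dots> = 0" using assms by (simp add: curve_ideal_def)
    finally show ?thesis .
  next
    case True
    then show ?thesis by (simp only: sum.empty)
  qed
  then show "coeff (leading_image n (initial_form f)) s = coeff 0 s"
    by (simp add: leading_image_def coeff_weighted_part)
qed

text \<open>The difference of two monomials of equal weight lies in the curve ideal. Its initial form is the
  monomial of smaller degree, or the whole difference if the degrees agree.\<close>
lemma monomial_mod_initial_ideal:
  fixes c :: "'k::field"
  assumes w: "weight n m' = weight n m" and max: "degree_maximal n m'"
  shows "Poly_Mapping.single m c - (if degree_maximal n m then Poly_Mapping.single m' c else 0)
     \<in> initial_ideal (curve_ideal n)"
proof -
  let ?f = "Poly_Mapping.single m c - Poly_Mapping.single m' c"
  let ?h = "Poly_Mapping.single m c - (if degree_maximal n m then Poly_Mapping.single m' c else 0)"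
  have "?f \<in> curve_ideal n"
    using w by (simp add: curve_ideal_def curve_map_eq_weighted_part weighted_part_diff weighted_part_single)
  then have f: "initial_form ?f \<in> initial_ideal (curve_ideal n)"
    unfolding initial_ideal_def using ideal_gen_superset by blast
  have eq: "initial_form ?f = ?h" if "?h \<noteq> 0"
  proof (cases "degree_maximal n m")
    case True
    then have "mdeg m = mdeg m'" using w max unfolding degree_maximal_def by (metis le_antisym)
    then have "initial_form (?h + 0) = ?h"
      using that True Poly_Mapping.keys_diff[of "Poly_Mapping.single m c" "Poly_Mapping.single m' c"]
      by (intro initial_form_eqI[where d = "mdeg m"]) (auto split: if_splits)
    then show ?thesis using True by simp
  next
    case False
    then have "mdeg m < mdeg m'"
      using w max unfolding degree_maximal_def by (metis le_trans not_le)
    then have "initial_form (?h + - Poly_Mapping.single m' c) = ?h"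
      using that False
      by (intro initial_form_eqI[where d = "mdeg m"]) (auto simp flip: single_uminus split: if_splits)
    then show ?thesis using False by simp
  qed
  have zero: "0 \<in> initial_ideal (curve_ideal n :: ('a, 'k) mpoly set)"
    unfolding initial_ideal_def using ideal_mpoly_ringD(1)[OF ideal_ideal_gen] by blast
  show ?thesis
  proof (cases "?h = 0")
    case True
    show ?thesis unfolding True by (rule zero)
  next
    case False
    show ?thesis using f unfolding eq[OF False] .
  qed
qed

text \<open>For the inclusion of the kernel in the initial ideal, each monomial is replaced modulo the initial
  ideal by \<open>0\<close> or by a degree-maximal representative \<open>r m\<close> of its weight. The coefficients that
  then collect at a representative are those of the leading image.\<close>
theorem initial_ideal_curve_ideal:
  assumes pos: "\<And>i. 0 < n i"
  shows "initial_ideal (curve_ideal n :: ('x::finite, 'k::field) mpoly set) = {f. leading_image n f = 0}"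
proof
  have "initial_form ` (curve_ideal n :: ('x, 'k) mpoly set) \<subseteq> {f. leading_image n f = 0}"
    by (rule image_subsetI) (simp add: leading_image_initial_form)
  then show "initial_ideal (curve_ideal n :: ('x, 'k) mpoly set) \<subseteq> {f. leading_image n f = 0}"
    unfolding initial_ideal_def
    by (rule ideal_gen_least[OF ideal_ker_leading_image])
next
  let ?I = "initial_ideal (curve_ideal n :: ('x, 'k) mpoly set)"
  have I: "ideal ?I mpoly_ring" unfolding initial_ideal_def by (rule ideal_ideal_gen)
  \<comment> \<open>Only the weight of \<open>m\<close> enters the choice, so \<open>r m = r m'\<close> for equal weights.\<close>
  define r where "r m = (SOME m'. degree_maximal n m' \<and> weight n m' = weight n m)" for m
  have "\<exists>m'. degree_maximal n m' \<and> weight n m' = weight n m" for m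
    using degree_maximal_exists[of n m, OF pos] by blast
  then have "degree_maximal n (r m) \<and> weight n (r m) = weight n m" for m
    unfolding r_def by (rule someI_ex)
  then have max: "degree_maximal n (r m)" and w: "weight n (r m) = weight n m" for m by auto
  have r: "r m = r m' \<longleftrightarrow> weight n m = weight n m'" for m m'
    using w by (metis r_def)
  show "{f. leading_image n f = 0} \<subseteq> ?I"
  proof
    fix f :: "('x, 'k) mpoly" assume "f \<in> {f. leading_image n f = 0}"
    then have f: "leading_image n f = 0" by simp
    let ?g = "\<lambda>m. if degree_maximal n m then Poly_Mapping.single (r m) (Poly_Mapping.lookup f m) else 0"
    have "(\<Sum>m\<in>A. Poly_Mapping.single m (Poly_Mapping.lookup f m) - ?g m) \<in> ?I" if "finite A" for A
      using that
    proof induction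
      case (insert m A)
      show ?case unfolding sum.insert[OF insert.hyps]
        by (intro ideal_mpoly_ringD(2)[OF I] insert.IH monomial_mod_initial_ideal w max)
    qed (use ideal_mpoly_ringD(1)[OF I] in simp)
    then have diff: "(\<Sum>m\<in>Poly_Mapping.keys f. Poly_Mapping.single m (Poly_Mapping.lookup f m))
        - (\<Sum>m\<in>Poly_Mapping.keys f. ?g m) \<in> ?I"
      unfolding sum_subtractf[symmetric] by simp
    have zero: "(\<Sum>m\<in>Poly_Mapping.keys f. ?g m) = 0"
    proof (rule poly_mapping_eqI)
      fix k
      have "Poly_Mapping.lookup (\<Sum>m\<in>Poly_Mapping.keys f. ?g m) k
          = (\<Sum>m\<in>Poly_Mapping.keys f. if degree_maximal n m \<and> r m = k then Poly_Mapping.lookup f m else 0)"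
        unfolding lookup_sum by (intro sum.cong) (auto simp: lookup_single when_def)
      also have "\<dots> = (if r k = k then coeff (leading_image n f) (weight n k) else 0)"
      proof (cases "r k = k")
        case True
        then have "r m = k \<longleftrightarrow> weight n m = weight n k" for m using r by metis
        then show ?thesis using True
          unfolding leading_image_def coeff_weighted_part by (simp add: sum.inter_filter)
      next
        case False
        then have "r m \<noteq> k" for m using r w by metis
        then show ?thesis using False by simp
      qed
      finally show "Poly_Mapping.lookup (\<Sum>m\<in>Poly_Mapping.keys f. ?g m) k = Poly_Mapping.lookup 0 k"
        using f by simp
    qed
    have expand: "(\<Sum>m\<in>Poly_Mapping.keys f. Poly_Mapping.single m (Poly_Mapping.lookup f m)) = f"
      by (rule poly_mapping_eqI) (simp add: lookup_sum lookup_single when_def in_keys_iff)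
    show "f \<in> ?I" using diff unfolding zero expand by (rule back_subst) simp
  qed
qed

section \<open>The tangent cone of a monomial curve as an algebra over its least variable\<close>
definition var_eval :: "'x \<Rightarrow> 'k::comm_ring_1 poly \<Rightarrow> ('x, 'k) mpoly" where
  "var_eval v p = poly (map_poly (Poly_Mapping.single 0) p) (var v)"

lemma var_eval_0 [simp]: "var_eval v 0 = 0"
  by (simp add: var_eval_def)

lemma var_eval_pCons:
  "var_eval v (pCons a p) = Poly_Mapping.single 0 a + var v * var_eval v p"
  by (simp add: var_eval_def map_poly_pCons)

lemma var_eval_add: "var_eval (v :: 'a) (p + q) = var_eval v p + var_eval v q"
proof -
  have "map_poly (Poly_Mapping.single (0 :: 'a \<Rightarrow>\<^sub>0 nat)) (p + q) =
      map_poly (Poly_Mapping.single 0) p + map_poly (Poly_Mapping.single 0) q"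
    by (rule poly_eqI) (simp add: coeff_map_poly single_add)
  then show ?thesis by (simp add: var_eval_def [where v = v])
qed

lemma var_eval_smult: "var_eval v (smult a q) = Poly_Mapping.single 0 a * var_eval v q"
  by (induction q) (simp_all add: var_eval_pCons mult_single algebra_simps)

lemma var_eval_mult: "var_eval v (p * q) = var_eval v p * var_eval v q"
  by (induction p)
    (simp_all add: var_eval_pCons var_eval_add var_eval_smult algebra_simps)

lemma var_eval_monom: "var_eval v (Polynomial.monom c k) = Poly_Mapping.single (Poly_Mapping.single v k) c"
  by (induction k)
    (simp_all add: monom_0 monom_Suc var_eval_pCons var_def mult_single single_add [symmetric])

definition on_axis :: "'x \<Rightarrow> ('x \<Rightarrow>\<^sub>0 nat) \<Rightarrow> bool" where
  "on_axis v m \<longleftrightarrow> (\<forall>i. i \<noteq> v \<longrightarrow> Poly_Mapping.lookup m i = 0)"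

lemma on_axis_add: "on_axis v (m + k) \<longleftrightarrow> on_axis v m \<and> on_axis v k"
  by (auto simp: on_axis_def lookup_add)

lemma on_axisD: "on_axis v m \<Longrightarrow> m = Poly_Mapping.single v (Poly_Mapping.lookup m v)"
  by (rule poly_mapping_eqI) (auto simp: on_axis_def lookup_single when_def)

text \<open>The substitution of \<open>0\<close> for all variables except \<open>v\<close>.\<close>
definition axis_restriction :: "'x \<Rightarrow> ('x, 'k::comm_ring_1) mpoly \<Rightarrow> 'k poly" where
  "axis_restriction v = weighted_part (on_axis v) (\<lambda>m. Poly_Mapping.lookup m v)"

lemma axis_restriction_add: "axis_restriction v (f + g) = axis_restriction v f + axis_restriction v g"
  by (simp add: axis_restriction_def weighted_part_add)

lemma axis_restriction_mult: "axis_restriction v (f * g) = axis_restriction v f * axis_restriction v g"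
proof (induction f rule: mpoly_additive_induct)
  case (single m c)
  show ?case
  proof (induction g rule: mpoly_additive_induct)
    case (single m' c')
    show ?case
      by (simp add: axis_restriction_def mult_single weighted_part_single on_axis_add lookup_add mult_monom)
  qed (simp add: distrib_left axis_restriction_add)
qed (simp add: distrib_right axis_restriction_add)

lemma axis_restriction_var_eval: "axis_restriction v (var_eval v p) = p"
proof (induction p)
  case 0
  then show ?case by (simp add: axis_restriction_def)
next
  case (pCons a p)
  then show ?case
    by (simp add: var_eval_pCons axis_restriction_add axis_restriction_mult)
      (simp add: axis_restriction_def weighted_part_single var_def on_axis_def lookup_single
        when_def monom_0 monom_Suc)
qed

lemma sum_in_ideal:
  assumes "ideal I (mpoly_ring :: ('x, 'k::comm_ring_1) mpoly ring)" "\<And>a. a \<in> A \<Longrightarrow> f a \<in> I"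
  shows "sum f A \<in> I"
  using assms(2)
  by (induction A rule: infinite_finite_induct) (auto intro: ideal_mpoly_ringD[OF assms(1)])

lemma nilpotent_mod_add:
  assumes I: "ideal I (mpoly_ring :: ('x, 'k::comm_ring_1) mpoly ring)"
    and "f ^ M \<in> I" "g ^ N \<in> I"
  shows "(f + g) ^ (M + N) \<in> I"
  unfolding binomial_ring
proof (rule sum_in_ideal[OF I])
  fix k assume "k \<in> {..M + N}"
  show "of_nat (M + N choose k) * f ^ k * g ^ (M + N - k) \<in> I"
  proof (cases "M \<le> k")
    case True
    then have "f ^ k = f ^ (k - M) * f ^ M" by (simp flip: power_add)
    then have "of_nat (M + N choose k) * f ^ k * g ^ (M + N - k) =
        (of_nat (M + N choose k) * f ^ (k - M) * g ^ (M + N - k)) * f ^ M"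
      by (simp add: ac_simps)
    then show ?thesis using ideal_mpoly_ringD(3)[OF I assms(2)] by metis
  next
    case False
    then have "M + N - k = (M - k) + N" by simp
    then have "g ^ (M + N - k) = g ^ (M - k) * g ^ N" by (simp only: power_add)
    then have "of_nat (M + N choose k) * f ^ k * g ^ (M + N - k) =
        (of_nat (M + N choose k) * f ^ k * g ^ (M - k)) * g ^ N"
      by (simp add: ac_simps)
    then show ?thesis using ideal_mpoly_ringD(3)[OF I assms(3)] by metis
  qed
qed

text \<open>What the restriction to the axis of \<open>v\<close> loses is a sum of multiples of the other variables, which
  are nilpotent modulo \<open>I\<close>.\<close>
lemma nilpotent_mod_off_axis:
  assumes I: "ideal I (mpoly_ring :: ('x, 'k::comm_ring_1) mpoly ring)"
    and var: "\<And>i. i \<noteq> v \<Longrightarrow> var i ^ N \<in> I"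
  shows "\<exists>K. (f - var_eval v (axis_restriction v f)) ^ K \<in> I"
proof (induction f rule: mpoly_additive_induct)
  case (single m c)
  show ?case
  proof (cases "on_axis v m")
    case True
    then have "Poly_Mapping.single m c - var_eval v (axis_restriction v (Poly_Mapping.single m c)) = 0"
      using on_axisD[OF True]
      by (simp add: axis_restriction_def weighted_part_single var_eval_monom)
    then show ?thesis using ideal_mpoly_ringD(1)[OF I] by (intro exI[of _ 1]) simp
  next
    case False
    then obtain i where i: "i \<noteq> v" "Poly_Mapping.lookup m i \<noteq> 0" by (auto simp: on_axis_def)
    have "m = (m - Poly_Mapping.single i 1) + Poly_Mapping.single i 1"
      using i(2) by (intro poly_mapping_eqI) (auto simp: lookup_add lookup_minus lookup_single when_def)
    then have "Poly_Mapping.single m c = Poly_Mapping.single (m - Poly_Mapping.single i 1) c * var i"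
      by (simp add: var_def mult_single)
    then have "Poly_Mapping.single m c ^ N \<in> I"
      using ideal_mpoly_ringD(3)[OF I var[OF i(1)]] by (simp add: power_mult_distrib)
    then show ?thesis using False
      by (auto simp: axis_restriction_def weighted_part_single)
  qed
next
  case (add f g)
  then obtain M N where
    "(f - var_eval v (axis_restriction v f)) ^ M \<in> I" "(g - var_eval v (axis_restriction v g)) ^ N \<in> I"
    by blast
  from nilpotent_mod_add[OF I this] show ?case
    by (auto simp: axis_restriction_add var_eval_add algebra_simps)
qed

lemma leading_image_const_mult:
  "leading_image n (Poly_Mapping.single 0 a * f) = smult a (leading_image n f)"
proof (induction f rule: mpoly_additive_induct)
  case (single m c)
  show ?case by (simp add: leading_image_def mult_single weighted_part_single smult_monom)
qed (simp add: distrib_left leading_image_add smult_add_right)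

lemma leading_image_var_mult:
  assumes step: "\<And>m. degree_maximal n m \<Longrightarrow> degree_maximal n (m + Poly_Mapping.single v 1)"
  shows "leading_image n (var v * f) = Polynomial.monom 1 (n v) * leading_image n f"
proof (induction f rule: mpoly_additive_induct)
  case (single m c)
  have "degree_maximal n (Poly_Mapping.single v 1 + m) \<longleftrightarrow> degree_maximal n m"
    using step degree_maximal_divisor by (metis add.commute)
  then show ?case
    by (simp add: leading_image_def var_def mult_single weighted_part_single weight_add mult_monom)
qed (simp add: distrib_left leading_image_add)

text \<open>If adding \<open>v\<close> keeps monomials degree-maximal, then the tangent cone embeds into \<open>K[t]\<close> as a module
  over \<open>K[x\<^sub>v]\<close>, where \<open>x\<^sub>v\<close> acts as \<open>t\<close> to the power \<open>n v\<close>. In particular it is torsion-free.\<close>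
lemma leading_image_var_eval_mult:
  fixes f :: "('x::finite, 'k::comm_ring_1) mpoly"
  assumes step: "\<And>m. degree_maximal n m \<Longrightarrow> degree_maximal n (m + Poly_Mapping.single v 1)"
  shows "leading_image n (var_eval v p * f) = pcompose p (Polynomial.monom 1 (n v)) * leading_image n f"
proof -
  have var: "leading_image n (var v * g) = Polynomial.monom 1 (n v) * leading_image n g"
    for g :: "('x, 'k) mpoly"
    by (rule leading_image_var_mult) (rule step)
  show ?thesis
  proof (induction p)
    case 0
    show ?case by (simp add: leading_image_def)
  next
    case (pCons a p)
    have "leading_image n (var_eval v (pCons a p) * f) =
        leading_image n (Poly_Mapping.single 0 a * f) + leading_image n (var v * (var_eval v p * f))"
      by (simp add: var_eval_pCons distrib_right mult.assoc leading_image_add)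
    also have "\<dots> = pcompose (pCons a p) (Polynomial.monom 1 (n v)) * leading_image n f"
      unfolding leading_image_const_mult var pCons.IH pcompose_pCons
      by (simp add: distrib_right mult.assoc)
    finally show ?case .
  qed
qed

text \<open>The least weight belongs to \<open>v\<close>, so monomials of a given degree are lightest on the axis of \<open>v\<close>.\<close>
lemma weight_ge_mdeg:
  assumes "\<And>i. i \<noteq> v \<Longrightarrow> n v < n i"
  shows "n v * mdeg m \<le> weight n m" "weight n m = n v * mdeg m \<Longrightarrow> on_axis v m"
proof -
  have le: "n v * Poly_Mapping.lookup m i \<le> n i * Poly_Mapping.lookup m i" for i
    using assms[of i] by (cases "i = v") auto
  then show "n v * mdeg m \<le> weight n m"
    unfolding mdeg_def weight_def sum_distrib_left by (intro sum_mono)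
  show "on_axis v m" if "weight n m = n v * mdeg m"
  proof (rule ccontr)
    assume "\<not> on_axis v m"
    then obtain i where "i \<noteq> v" "Poly_Mapping.lookup m i \<noteq> 0" by (auto simp: on_axis_def)
    then have "n v * Poly_Mapping.lookup m i < n i * Poly_Mapping.lookup m i"
      using assms by simp
    then have "n v * mdeg m < weight n m"
      unfolding mdeg_def weight_def sum_distrib_left using le
      by (intro sum_strict_mono_ex1) auto
    with that show False by simp
  qed
qed

lemma degree_maximal_on_axis_iff:
  assumes least: "\<And>i. i \<noteq> v \<Longrightarrow> n v < n i" and pos: "0 < n v"
  shows "degree_maximal n m \<and> weight n m = n v * k \<longleftrightarrow> m = Poly_Mapping.single v k"
proof
  assume m: "degree_maximal n m \<and> weight n m = n v * k"
  then have "k \<le> mdeg m" unfolding degree_maximal_def by (metis mdeg_single weight_single)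
  then have "weight n m \<le> n v * mdeg m" using m by simp
  then have "on_axis v m" using weight_ge_mdeg[of v n m] least by fastforce
  then have "m = Poly_Mapping.single v (Poly_Mapping.lookup m v)" by (rule on_axisD)
  then obtain j where j: "m = Poly_Mapping.single v j" by blast
  then show "m = Poly_Mapping.single v k" using m pos by simp
next
  assume m: "m = Poly_Mapping.single v k"
  have "mdeg m' \<le> k" if "weight n m' = n v * k" for m'
    using weight_ge_mdeg(1)[of v n m'] least that pos by auto
  then show "degree_maximal n m \<and> weight n m = n v * k"
    by (simp add: m degree_maximal_def)
qed

text \<open>Powers of \<open>x\<^sub>v\<close> are the only degree-maximal monomials of their weights. Hence the restriction to the
  axis vanishes on the initial ideal.\<close>
lemma coeff_leading_image_axis:
  assumes least: "\<And>i. i \<noteq> v \<Longrightarrow> n v < n i" and pos: "0 < n v"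
  shows "coeff (leading_image n f) (n v * k) = coeff (axis_restriction v f) k"
proof (induction f rule: mpoly_additive_induct)
  case (single m c)
  have "on_axis v m \<and> Poly_Mapping.lookup m v = k \<longleftrightarrow> m = Poly_Mapping.single v k"
    by (metis on_axisD lookup_single_eq on_axis_def lookup_single_not_eq)
  moreover have "coeff (leading_image n (Poly_Mapping.single m c)) (n v * k)
      = (if degree_maximal n m \<and> weight n m = n v * k then c else 0)"
    by (simp add: leading_image_def weighted_part_single)
  moreover have "coeff (axis_restriction v (Poly_Mapping.single m c)) k
      = (if on_axis v m \<and> Poly_Mapping.lookup m v = k then c else 0)"
    by (simp add: axis_restriction_def weighted_part_single)
  ultimately show ?case using degree_maximal_on_axis_iff[of v n m k] least pos by simp
qed (simp add: leading_image_add axis_restriction_add)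

text \<open>\<open>x\<^sub>i\<close> to the power \<open>n v\<close> has the weight of \<open>x\<^sub>v\<close> to the power \<open>n i\<close>, which has larger degree.\<close>
lemma not_degree_maximal_large_exponent:
  assumes least: "\<And>i. i \<noteq> v \<Longrightarrow> n v < n i" and pos: "0 < n v"
    and "i \<noteq> v" "n v \<le> Poly_Mapping.lookup m i"
  shows "\<not> degree_maximal n m"
proof
  assume max: "degree_maximal n m"
  have "m = Poly_Mapping.single i (n v) + (m - Poly_Mapping.single i (n v))"
    using assms(4) by (intro poly_mapping_eqI) (auto simp: lookup_add lookup_minus lookup_single when_def)
  with max have "degree_maximal n (Poly_Mapping.single i (n v))"
    using degree_maximal_divisor by metis
  then have "mdeg (Poly_Mapping.single v (n i)) \<le> mdeg (Poly_Mapping.single i (n v))"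
    unfolding degree_maximal_def by (metis weight_single mult.commute)
  with least[OF assms(3)] show False by simp
qed

lemma finite_bounded_exponents: "finite {m :: 'x::finite \<Rightarrow>\<^sub>0 nat. \<forall>i. Poly_Mapping.lookup m i < N}"
proof (rule finite_imageD)
  show "inj_on Poly_Mapping.lookup {m :: 'x \<Rightarrow>\<^sub>0 nat. \<forall>i. Poly_Mapping.lookup m i < N}"
    by (auto simp: inj_on_def)
  have "Poly_Mapping.lookup ` {m :: 'x \<Rightarrow>\<^sub>0 nat. \<forall>i. Poly_Mapping.lookup m i < N}
      \<subseteq> PiE UNIV (\<lambda>_. {..<N})" by auto
  then show "finite (Poly_Mapping.lookup ` {m :: 'x \<Rightarrow>\<^sub>0 nat. \<forall>i. Poly_Mapping.lookup m i < N})"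
    by (rule finite_subset) (auto intro: finite_PiE)
qed

lemma poly_algebra_var_eval: "poly_algebra (var_eval v :: 'k::field poly \<Rightarrow> ('x, 'k) mpoly)"
proof
  show "var_eval v (1 :: 'k poly) = (1 :: ('x, 'k) mpoly)"
    by (simp add: one_pCons var_eval_pCons)
qed (simp_all add: var_eval_add var_eval_mult)

text \<open>Monomials with an exponent of at least \<open>n v\<close> off the axis of \<open>v\<close> lie in the kernel, and every other one is
  a power of \<open>x\<^sub>v\<close> times one of finitely many.\<close>
lemma spans_mod_ker_leading_image:
  fixes f :: "('x::finite, 'k::field) mpoly"
  assumes least: "\<And>i. i \<noteq> v \<Longrightarrow> n v < n i" and pos: "0 < n v"
  shows "poly_algebra.spans_mod (var_eval v) {f. leading_image n f = 0}
    ((\<lambda>m. Poly_Mapping.single m 1) ` {m. \<forall>i. Poly_Mapping.lookup m i < n v}) f"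
    (is "poly_algebra.spans_mod _ ?J ?B f")
proof -
  interpret poly_algebra "var_eval v :: 'k poly \<Rightarrow> ('x, 'k) mpoly" by (rule poly_algebra_var_eval)
  have fin: "finite ?B" by (intro finite_imageI finite_bounded_exponents)
  have J: "submodule ?J"
    using ideal_mpoly_ringD[OF ideal_ker_leading_image[of n]] unfolding submodule_def by blast
  show ?thesis
  proof (induction f rule: mpoly_additive_induct)
    case (single m c)
    show ?case
    proof (cases "\<exists>i. i \<noteq> v \<and> n v \<le> Poly_Mapping.lookup m i")
      case True
      then have "\<not> degree_maximal n m" using not_degree_maximal_large_exponent[of v n] least pos by metis
      then show ?thesis
        by (intro spans_mod_sub[OF J]) (simp add: leading_image_def weighted_part_single)
    next
      case False
      define m0 where "m0 = m - Poly_Mapping.single v (Poly_Mapping.lookup m v)"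
      have m: "m = Poly_Mapping.single v (Poly_Mapping.lookup m v) + m0"
        unfolding m0_def by (intro poly_mapping_eqI) (auto simp: lookup_add lookup_minus lookup_single when_def)
      have "Poly_Mapping.lookup m0 i < n v" for i
        using False pos by (auto simp: m0_def lookup_minus lookup_single when_def not_le)
      then have B: "Poly_Mapping.single m0 1 \<in> ?B" by blast
      let ?c = "\<lambda>b. if b = Poly_Mapping.single m0 1 then Polynomial.monom c (Poly_Mapping.lookup m v) else 0"
      have "(\<Sum>b\<in>?B. var_eval v (?c b) * b) =
          (\<Sum>b\<in>?B. if b = Poly_Mapping.single m0 1
             then var_eval v (Polynomial.monom c (Poly_Mapping.lookup m v)) * b else 0)"
        by (intro sum.cong) auto
      also have "\<dots> = Poly_Mapping.single m c"
        using B fin m by (simp add: sum.delta var_eval_monom mult_single)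
      finally have eq: "Poly_Mapping.single m c - (\<Sum>b\<in>?B. var_eval v (?c b) * b) = 0" by simp
      have "0 \<in> ?J" by (simp add: leading_image_def)
      then show ?thesis unfolding spans_mod_def eq[symmetric] by (rule exI[of _ ?c])
    qed
  qed (rule spans_mod_add[OF J])
qed

text \<open>The criterion of the previous sections applies to the tangent cone with \<open>X = x\<^sub>v\<close>. If \<open>x\<^sub>v\<close> is a
  nonzerodivisor, it does not kill the class of a degree-maximal monomial.\<close>
theorem cohen_macaulay_tangent_cone_iff:
  fixes n :: "'x::finite \<Rightarrow> nat"
  assumes least: "\<And>i. i \<noteq> v \<Longrightarrow> n v < n i" and pos: "0 < n v"
  shows "cohen_macaulay_tangent_cone TYPE('k::field) n \<longleftrightarrow>
    (\<forall>m. degree_maximal n m \<longrightarrow> degree_maximal n (m + Poly_Mapping.single v 1))"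
proof -
  let ?R = "mpoly_ring :: ('x, 'k) mpoly ring"
  let ?J = "{f :: ('x, 'k) mpoly. leading_image n f = 0}"
  have "0 < n i" for i using least[of i] pos by (cases "i = v") auto
  then have J: "initial_ideal (curve_ideal n :: ('x, 'k) mpoly set) = ?J"
    by (rule initial_ideal_curve_ideal)
  interpret J: ideal ?J ?R by (rule ideal_ker_leading_image)
  interpret A: cring "?R Quot ?J" by (rule J.quotient_is_cring) (rule cring_mpoly_ring)
  interpret poly_algebra "var_eval v :: 'k poly \<Rightarrow> ('x, 'k) mpoly" by (rule poly_algebra_var_eval)
  let ?\<pi> = "(+>\<^bsub>?R\<^esub>) ?J"
  have zero: "\<zero>\<^bsub>?R Quot ?J\<^esub> = ?J" by (simp add: FactRing_def)
  have carrier: "carrier ?R = UNIV" by (simp add: mpoly_ring_def)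
  have ker: "?\<pi> f = \<zero>\<^bsub>?R Quot ?J\<^esub> \<longleftrightarrow> leading_image n f = 0" for f
  proof
    assume "?\<pi> f = \<zero>\<^bsub>?R Quot ?J\<^esub>"
    then have "f \<in> ?J" using J.a_rcos_self[of f] unfolding zero carrier by simp
    then show "leading_image n f = 0" by simp
  next
    assume "leading_image n f = 0"
    then show "?\<pi> f = \<zero>\<^bsub>?R Quot ?J\<^esub>" unfolding zero by (intro J.a_rcos_const) simp
  qed
  note hom = J.rcos_ring_hom
  interpret poly_retract "var_eval v :: 'k poly \<Rightarrow> ('x, 'k) mpoly" "?R Quot ?J" ?\<pi> "axis_restriction v"
  proof
    show "range ?\<pi> = carrier (?R Quot ?J)"
      by (auto simp: FactRing_def A_RCOSETS_def' carrier)
    fix f g :: "('x, 'k) mpoly" and p :: "'k poly"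
    show "?\<pi> (f + g) = ?\<pi> f \<oplus>\<^bsub>?R Quot ?J\<^esub> ?\<pi> g"
      using ring_hom_add[OF hom, of f g] by (simp add: mpoly_ring_def)
    show "?\<pi> (f * g) = ?\<pi> f \<otimes>\<^bsub>?R Quot ?J\<^esub> ?\<pi> g"
      using ring_hom_mult[OF hom, of f g] by (simp add: mpoly_ring_def)
    show "?\<pi> 1 = \<one>\<^bsub>?R Quot ?J\<^esub>"
      using ring_hom_one[OF hom] by (simp add: mpoly_ring_def)
    show "axis_restriction v (f + g) = axis_restriction v f + axis_restriction v g"
      by (rule axis_restriction_add)
    show "axis_restriction v (f * g) = axis_restriction v f * axis_restriction v g"
      by (rule axis_restriction_mult)
    show "axis_restriction v (var_eval v p :: ('x, 'k) mpoly) = p"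
      by (rule axis_restriction_var_eval)
    show "axis_restriction v f = 0" if "?\<pi> f = \<zero>\<^bsub>?R Quot ?J\<^esub>"
    proof (rule poly_eqI)
      fix k
      show "coeff (axis_restriction v f) k = coeff 0 k"
        using that coeff_leading_image_axis[of v n f k] least pos unfolding ker by simp
    qed
    show "\<exists>N. ?\<pi> (f ^ N) = \<zero>\<^bsub>?R Quot ?J\<^esub>" if f: "axis_restriction v f = 0"
    proof -
      have "var i ^ n v \<in> ?J" if "i \<noteq> v" for i
        using not_degree_maximal_large_exponent[of v n i "Poly_Mapping.single i (n v)"] least pos that
        by (simp add: leading_image_def weighted_part_single var_power)
      from nilpotent_mod_off_axis[OF ideal_ker_leading_image this, of v f] f
      show ?thesis unfolding ker by simp
    qed
  qed
  have "noetherian_ring (?R Quot ?J)"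
  proof (rule noetherian_if_spanned)
    show "finite ((\<lambda>m. Poly_Mapping.single m 1 :: ('x, 'k) mpoly) ` {m. \<forall>i. Poly_Mapping.lookup m i < n v})"
      by (intro finite_imageI finite_bounded_exponents)
    show "spans_mod {f. ?\<pi> f = \<zero>\<^bsub>?R Quot ?J\<^esub>}
        ((\<lambda>m. Poly_Mapping.single m 1) ` {m. \<forall>i. Poly_Mapping.lookup m i < n v}) f" for f
      unfolding ker by (rule spans_mod_ker_leading_image) (use least pos in auto)
  qed
  moreover have "nonzerodivisor (var_eval v p)"
    if step: "\<forall>m. degree_maximal n m \<longrightarrow> degree_maximal n (m + Poly_Mapping.single v 1)" and "p \<noteq> 0" for p
  proof -
    have "pcompose p (Polynomial.monom 1 (n v)) \<noteq> 0"
      using pcompose_eq_0[of p "Polynomial.monom 1 (n v)"] pos \<open>p \<noteq> 0\<close> by (auto simp: degree_monom_eq)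
    then show ?thesis
      unfolding nonzerodivisor_def ker
      using leading_image_var_eval_mult[of n v p] step by auto
  qed
  moreover have "degree_maximal n (m + Poly_Mapping.single v 1)"
    if nzd: "nonzerodivisor (var_eval v [:0, 1:])" and max: "degree_maximal n m" for m
  proof -
    have "var_eval v [:0, 1:] = (var v :: ('x, 'k) mpoly)" by (simp add: var_eval_pCons)
    moreover have "leading_image n (Poly_Mapping.single m (1::'k)) \<noteq> 0"
      using max by (simp add: leading_image_def weighted_part_single)
    ultimately have "leading_image n (var v * Poly_Mapping.single m (1::'k)) \<noteq> 0"
      using nzd unfolding nonzerodivisor_def ker by metis
    then show ?thesis
      by (simp add: leading_image_def var_def mult_single weighted_part_single add.commute split: if_splits)
  qed
  ultimately show ?thesis
    unfolding cohen_macaulay_tangent_cone_def J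
    using cohen_macaulay_imp_nonzerodivisor cohen_macaulay_if_torsion_free by blast
qed

section \<open>Moves between monomials of equal weight\<close>
lemma degree_maximal_add_axis_iff:
  assumes pos: "\<And>i. 0 < n i"
  shows "(\<forall>m. degree_maximal n m \<longrightarrow> degree_maximal n (m + Poly_Mapping.single v 1)) \<longleftrightarrow>
    (\<forall>m m'. weight n m = weight n m' \<and> 0 < Poly_Mapping.lookup m v \<longrightarrow>
      (\<exists>m''. weight n m'' = weight n m' \<and> 0 < Poly_Mapping.lookup m'' v \<and> mdeg m' \<le> mdeg m''))"
    (is "?L \<longleftrightarrow> ?R")
proof -
  let ?e = "Poly_Mapping.single v (1 :: nat)"
  have split: "\<exists>u. m = u + ?e" if "0 < Poly_Mapping.lookup m v" for m
    using that by (intro exI[of _ "m - ?e"] poly_mapping_eqI)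
      (auto simp: lookup_add lookup_minus lookup_single when_def)
  show ?thesis
  proof
    assume L: ?L
    show ?R
    proof (intro allI impI)
      fix m m' assume m: "weight n m = weight n m' \<and> 0 < Poly_Mapping.lookup m v"
      then obtain u where u: "m = u + ?e" using split by blast
      obtain u' where u': "degree_maximal n u'" "weight n u' = weight n u"
        using degree_maximal_exists[of n u, OF pos] by blast
      have "weight n (u' + ?e) = weight n m'" using m u u'(2) by (simp add: weight_add)
      moreover have "mdeg m' \<le> mdeg (u' + ?e)"
        using L u'(1) calculation unfolding degree_maximal_def by metis
      ultimately show "\<exists>m''. weight n m'' = weight n m' \<and> 0 < Poly_Mapping.lookup m'' v \<and> mdeg m' \<le> mdeg m''"
        by (intro exI[of _ "u' + ?e"]) (simp add: lookup_add)
    qed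
  next
    assume R: ?R
    show ?L unfolding degree_maximal_def
    proof (intro allI impI)
      fix m m' assume m: "\<forall>m'. weight n m' = weight n m \<longrightarrow> mdeg m' \<le> mdeg m"
        and m': "weight n m' = weight n (m + ?e)"
      have "0 < Poly_Mapping.lookup (m + ?e) v" by (simp add: lookup_add)
      then obtain m'' where m'': "weight n m'' = weight n m'" "0 < Poly_Mapping.lookup m'' v"
        "mdeg m' \<le> mdeg m''" using R m' by metis
      then obtain u where "m'' = u + ?e" using split by blast
      then have "weight n u = weight n m" using m' m''(1) by (simp add: weight_add)
      then have "mdeg u \<le> mdeg m" using m by blast
      then show "mdeg m' \<le> mdeg (m + ?e)"
        using m''(3) \<open>m'' = u + ?e\<close> by (simp add: mdeg_add)
    qed
  qed
qed

definition monomial_diff :: "('x \<Rightarrow>\<^sub>0 nat) \<Rightarrow> ('x \<Rightarrow>\<^sub>0 nat) \<Rightarrow> ('x, 'k::comm_ring_1) mpoly" where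
  "monomial_diff a b = Poly_Mapping.single a 1 - Poly_Mapping.single b 1"

text \<open>If moves do not leave \<open>C\<close>, then the sum of the coefficients over \<open>C\<close> vanishes on the ideal that
  the binomials generate. Evaluation at the difference of two monomials of equal weight, which lies
  in the ideal of the curve, shows that \<open>C\<close> contains both or neither.\<close>
lemma move_closed_imp_weight_closed:
  assumes gen: "ideal_gen ((\<lambda>(a, b). monomial_diff a b) ` M) = (curve_ideal n :: ('x::finite, 'k::field) mpoly set)"
    and closed: "\<And>a b k. (a, b) \<in> M \<Longrightarrow> k + a \<in> C \<longleftrightarrow> k + b \<in> C"
    and w: "weight n m = weight n m'"
  shows "m \<in> C \<longleftrightarrow> m' \<in> C"
proof -
  let ?L = "weighted_part (\<lambda>m. m \<in> C) (\<lambda>_. 0) :: ('x, 'k) mpoly \<Rightarrow> 'k poly"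
  define I where "I = {f. \<forall>g. ?L (g * f) = 0}"
  have I: "ideal I mpoly_ring"
  proof (rule ideal_mpoly_ringI)
    fix f g assume "f \<in> I"
    then show "g * f \<in> I" by (simp add: I_def flip: mult.assoc)
  qed (auto simp: I_def distrib_left weighted_part_add)
  have "((\<lambda>(a, b). monomial_diff a b) ` M) \<subseteq> I"
  proof clarify
    fix a b assume ab: "(a, b) \<in> M"
    have "?L (g * monomial_diff a b) = 0" for g
    proof (induction g rule: mpoly_additive_induct)
      case (single k c)
      then show ?case using closed[OF ab, of k]
        by (simp add: monomial_diff_def right_diff_distrib mult_single weighted_part_diff weighted_part_single)
    qed (simp add: distrib_right weighted_part_add)
    then show "monomial_diff a b \<in> I" unfolding I_def by blast
  qed
  then have "ideal_gen ((\<lambda>(a, b). monomial_diff a b) ` M) \<subseteq> I" by (rule ideal_gen_least[OF I])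
  moreover have "Poly_Mapping.single m 1 - Poly_Mapping.single m' 1 \<in> (curve_ideal n :: ('x, 'k) mpoly set)"
    using w by (simp only: single_diff_in_curve_ideal)
  ultimately have "Poly_Mapping.single m 1 - Poly_Mapping.single m' 1 \<in> I" using gen by blast
  then have "?L (1 * (Poly_Mapping.single m 1 - Poly_Mapping.single m' 1)) = 0"
    unfolding I_def by blast
  then show ?thesis by (auto simp: weighted_part_diff weighted_part_single split: if_splits)
qed

section \<open>Gorenstein monomial curves in affine 4-space\<close>
definition vec4 :: "nat \<Rightarrow> nat \<Rightarrow> nat \<Rightarrow> nat \<Rightarrow> (4 \<Rightarrow>\<^sub>0 nat)" where
  "vec4 i j k l = Poly_Mapping.single 1 i + Poly_Mapping.single 2 j + Poly_Mapping.single 3 k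
     + Poly_Mapping.single 4 l"

lemma lookup_vec4:
  "Poly_Mapping.lookup (vec4 i j k l) 1 = i" "Poly_Mapping.lookup (vec4 i j k l) 2 = j"
  "Poly_Mapping.lookup (vec4 i j k l) 3 = k" "Poly_Mapping.lookup (vec4 i j k l) 4 = l"
  by (simp_all add: vec4_def lookup_add lookup_single when_def)

lemma vec4_lookup:
  "m = vec4 (Poly_Mapping.lookup m 1) (Poly_Mapping.lookup m 2) (Poly_Mapping.lookup m 3)
     (Poly_Mapping.lookup m 4)"
proof (rule poly_mapping_eqI)
  fix i :: 4
  show "Poly_Mapping.lookup m i = Poly_Mapping.lookup (vec4 (Poly_Mapping.lookup m 1)
      (Poly_Mapping.lookup m 2) (Poly_Mapping.lookup m 3) (Poly_Mapping.lookup m 4)) i"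
    using exhaust_4[of i] by (elim disjE) (simp_all only: lookup_vec4)
qed

lemma weight_vec4: "weight n (vec4 i j k l) = n 1 * i + n 2 * j + n 3 * k + n 4 * l"
  by (simp add: vec4_def weight_add)

lemma mdeg_vec4: "mdeg (vec4 i j k l) = i + j + k + l"
  by (simp add: vec4_def mdeg_add)

lemma all_vec4: "(\<forall>m. P m) \<longleftrightarrow> (\<forall>i j k l. P (vec4 i j k l))"
  by (metis vec4_lookup)

lemma ex_vec4: "(\<exists>m. P m) \<longleftrightarrow> (\<exists>i j k l. P (vec4 i j k l))"
  by (metis vec4_lookup)

text \<open>Here \<open>i, j, k, l\<close> are the exponents of a monomial, and \<open>closed\<close> says that a set \<open>Q\<close> of monomials that
  the five kinds of moves preserve is a union of classes of equal weight.\<close>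
lemma degree_condition_iff:
  fixes n :: "4 \<Rightarrow> nat" and a1 a2 a3 a4 a13 a14 a21 a23 a32 a34 a41 a42 :: nat
  defines "W \<equiv> \<lambda>i j k l. n 1 * i + n 2 * j + n 3 * k + n 4 * l"
  assumes pos: "0 < n 1" and mono: "n 1 \<le> n 2" "n 2 \<le> n 3" "n 3 \<le> n 4"
    and a_pos: "0 < a21" "0 < a41" "0 < a32" "0 < a42" "0 < a13" "0 < a23" "0 < a14" "0 < a34"
    and a: "a1 = a21 + a41" "a2 = a32 + a42" "a3 = a13 + a23" "a4 = a14 + a34"
    and weights: "W a1 0 0 0 = W 0 0 a13 a14" "W 0 a2 0 0 = W a21 0 a23 0"
      "W 0 0 a3 0 = W 0 a32 0 a34" "W 0 0 0 a4 = W a41 a42 0 0" "W a21 0 0 a34 = W 0 a42 a13 0"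
    and closed: "\<And>(Q :: nat \<Rightarrow> nat \<Rightarrow> nat \<Rightarrow> nat \<Rightarrow> bool) i j k l i' j' k' l'.
      \<lbrakk>\<And>i j k l. Q (i + a1) j k l \<longleftrightarrow> Q i j (k + a13) (l + a14);
       \<And>i j k l. Q i (j + a2) k l \<longleftrightarrow> Q (i + a21) j (k + a23) l;
       \<And>i j k l. Q i j (k + a3) l \<longleftrightarrow> Q i (j + a32) k (l + a34);
       \<And>i j k l. Q i j k (l + a4) \<longleftrightarrow> Q (i + a41) (j + a42) k l;
       \<And>i j k l. Q (i + a21) j k (l + a34) \<longleftrightarrow> Q i (j + a42) (k + a13) l;
       W i j k l = W i' j' k' l'; Q i j k l\<rbrakk> \<Longrightarrow> Q i' j' k' l'"
    and less: "a32 < a42" and le: "a14 \<le> a34"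
  shows "(\<forall>i j k l i' j' k' l'. W i j k l = W i' j' k' l' \<and> 0 < i \<longrightarrow>
      (\<exists>i'' j'' k'' l''. W i'' j'' k'' l'' = W i' j' k' l' \<and> 0 < i'' \<and>
         i' + j' + k' + l' \<le> i'' + j'' + k'' + l''))
    \<longleftrightarrow> a2 \<le> a21 + a23 \<and> a42 + a13 \<le> a21 + a34 \<and> a3 + a13 \<le> a1 + a32 + a34 - a14"
    (is "?L \<longleftrightarrow> ?R")
proof
  assume L: ?L
  have "a2 \<le> a21 + a23"
  proof -
    \<comment> \<open>Moves lead from \<open>x\<^sub>2^a2\<close> only to \<open>x\<^sub>1^a21 x\<^sub>3^a23\<close>, and from there only back.\<close>
    define Q where "Q i j k l \<longleftrightarrow> i = 0 \<and> j = a2 \<and> k = 0 \<and> l = 0 \<or>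
      i = a21 \<and> j = 0 \<and> k = a23 \<and> l = 0" for i j k l :: nat
    obtain i j k l where "W i j k l = W 0 a2 0 0" "0 < i" "a2 \<le> i + j + k + l"
      using L weights(2) a_pos by (metis add_0_left add_0_right)
    moreover have "Q i j k l" if "W 0 a2 0 0 = W i j k l" for i j k l
      by (rule closed[of Q, OF _ _ _ _ _ that]) (unfold Q_def, use a_pos a in auto)
    ultimately show ?thesis using a_pos unfolding Q_def by (metis add_0_right less_irrefl)
  qed
  moreover have "a42 + a13 \<le> a21 + a34"
  proof -
    \<comment> \<open>Likewise for \<open>x\<^sub>2^a42 x\<^sub>3^a13\<close> and \<open>x\<^sub>1^a21 x\<^sub>4^a34\<close>.\<close>
    define Q where "Q i j k l \<longleftrightarrow> i = 0 \<and> j = a42 \<and> k = a13 \<and> l = 0 \<or>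
      i = a21 \<and> j = 0 \<and> k = 0 \<and> l = a34" for i j k l :: nat
    obtain i j k l where "W i j k l = W 0 a42 a13 0" "0 < i" "a42 + a13 \<le> i + j + k + l"
      using L weights(5) a_pos by (metis add_0_left add_0_right)
    moreover have "Q i j k l" if "W 0 a42 a13 0 = W i j k l" for i j k l
      by (rule closed[of Q, OF _ _ _ _ _ that]) (unfold Q_def, use a_pos a in auto)
    ultimately show ?thesis using a_pos unfolding Q_def by (metis add_0_right less_irrefl)
  qed
  moreover have "a3 + a13 \<le> a1 + a32 + a34 - a14"
  proof -
    \<comment> \<open>From \<open>x\<^sub>3^(a3 + a13)\<close> one gets to \<open>x\<^sub>2^a32 x\<^sub>3^a13 x\<^sub>4^a34\<close> and on to
      \<open>x\<^sub>1^a1 x\<^sub>2^a32 x\<^sub>4^(a34 - a14)\<close>, and no further: \<open>a32 < a42\<close> excludes the moves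
      that need \<open>x\<^sub>2^a42\<close>.\<close>
    define Q where "Q i j k l \<longleftrightarrow> i = 0 \<and> j = 0 \<and> k = a3 + a13 \<and> l = 0 \<or>
      i = 0 \<and> j = a32 \<and> k = a13 \<and> l = a34 \<or> i = a1 \<and> j = a32 \<and> k = 0 \<and> l + a14 = a34" for i j k l :: nat
    have Q: "Q i j k l" if "W 0 0 (a3 + a13) 0 = W i j k l" for i j k l
      by (rule closed[of Q, OF _ _ _ _ _ that]) (unfold Q_def, use a_pos a less le in auto)
    have "W a1 a32 0 (a34 - a14) = W 0 0 (a3 + a13) 0" "0 < a1"
      using weights(1,3) le a_pos a unfolding W_def by (auto simp: algebra_simps)
    then obtain i j k l where "W i j k l = W 0 0 (a3 + a13) 0" "0 < i" "a3 + a13 \<le> i + j + k + l"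
      using L by (metis add_0_left add_0_right)
    with Q[of i j k l] show ?thesis unfolding Q_def by auto
  qed
  ultimately show ?R by blast
next
  assume R: ?R
  have d1: "a13 + a14 \<le> a1"
  proof -
    have "n 1 * (a13 + a14) \<le> n 3 * a13 + n 4 * a14"
      unfolding distrib_left by (intro add_mono mult_right_mono) (use mono in auto)
    also have "\<dots> = n 1 * a1" using weights(1) by (simp add: W_def)
    finally show ?thesis using pos by simp
  qed
  have d4: "a4 \<le> a41 + a42"
  proof -
    have "n 4 * a4 = n 1 * a41 + n 2 * a42" using weights(4) by (simp add: W_def)
    also have "\<dots> \<le> n 4 * (a41 + a42)"
      unfolding distrib_left by (intro add_mono mult_right_mono) (use mono in auto)
    finally show ?thesis using pos mono by simp
  qed
  \<comment> \<open>The first four monomials are the sides without \<open>x\<^sub>1\<close> of generators that contain \<open>x\<^sub>1\<close>. The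
    last one is due to \<open>x\<^sub>2^a32 x\<^sub>3^a13 x\<^sub>4^a34\<close>, a multiple of the first, from which a move leads to
    \<open>x\<^sub>3^(a3 + a13)\<close>.\<close>
  define Q where "Q i j k l \<longleftrightarrow> 0 < i \<or> a13 \<le> k \<and> a14 \<le> l \<or> a2 \<le> j \<or> a4 \<le> l \<or>
    a42 \<le> j \<and> a13 \<le> k \<or> a3 + a13 \<le> k" for i j k l :: nat
  show ?L
  proof (intro allI impI)
    fix i j k l i' j' k' l' assume *: "W i j k l = W i' j' k' l' \<and> 0 < i"
    then have "W i j k l = W i' j' k' l'" and "Q i j k l" by (simp_all add: Q_def)
    then have "Q i' j' k' l'"
      by (rule closed[of Q, rotated -2]) (unfold Q_def, use a_pos a le in auto)
    then show "\<exists>i'' j'' k'' l''. W i'' j'' k'' l'' = W i' j' k' l' \<and> 0 < i'' \<and>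
         i' + j' + k' + l' \<le> i'' + j'' + k'' + l''"
      unfolding Q_def
    proof (elim disjE conjE)
      assume "0 < i'"
      then show ?thesis by blast
    next
      assume "a13 \<le> k'" "a14 \<le> l'"
      then obtain k0 l0 where "k' = a13 + k0" "l' = a14 + l0" by (metis le_Suc_ex)
      then show ?thesis using weights(1) d1 a_pos a
        by (intro exI[of _ "i' + a1"] exI[of _ j'] exI[of _ k0] exI[of _ l0])
          (auto simp: W_def algebra_simps)
    next
      assume "a2 \<le> j'"
      then obtain j0 where "j' = a2 + j0" by (metis le_Suc_ex)
      then show ?thesis using weights(2) R a_pos
        by (intro exI[of _ "i' + a21"] exI[of _ j0] exI[of _ "k' + a23"] exI[of _ l'])
          (auto simp: W_def algebra_simps)
    next
      assume "a4 \<le> l'"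
      then obtain l0 where "l' = a4 + l0" by (metis le_Suc_ex)
      then show ?thesis using weights(4) d4 a_pos
        by (intro exI[of _ "i' + a41"] exI[of _ "j' + a42"] exI[of _ k'] exI[of _ l0])
          (auto simp: W_def algebra_simps)
    next
      assume "a42 \<le> j'" "a13 \<le> k'"
      then obtain j0 k0 where "j' = a42 + j0" "k' = a13 + k0" by (metis le_Suc_ex)
      then show ?thesis using weights(5) R a_pos
        by (intro exI[of _ "i' + a21"] exI[of _ j0] exI[of _ k0] exI[of _ "l' + a34"])
          (auto simp: W_def algebra_simps)
    next
      assume "a3 + a13 \<le> k'"
      then obtain k0 where k0: "k' = (a3 + a13) + k0" by (metis le_Suc_ex)
      obtain d where d: "a34 = a14 + d" using le by (metis le_Suc_ex)
      show ?thesis using weights(1,3) R a_pos a unfolding k0 d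
        by (intro exI[of _ "i' + a1"] exI[of _ "j' + a32"] exI[of _ k0] exI[of _ "l' + d"])
          (auto simp: W_def algebra_simps)
    qed
  qed
qed

lemma weight_eq_of_generator:
  assumes "ideal_gen ((\<lambda>(a, b). monomial_diff a b) ` M) = (curve_ideal n :: ('x::finite, 'k::field) mpoly set)"
    and "(a, b) \<in> M"
  shows "weight n a = weight n b"
proof -
  have "monomial_diff a b \<in> ((\<lambda>(a, b). monomial_diff a b) ` M :: ('x, 'k) mpoly set)"
    using assms(2) by force
  then have "monomial_diff a b \<in> (curve_ideal n :: ('x, 'k) mpoly set)"
    using ideal_gen_superset assms(1) by blast
  then show ?thesis unfolding monomial_diff_def by (simp only: single_diff_in_curve_ideal)
qed

theorem theorem3p13:
  fixes n :: "4 \<Rightarrow> nat"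
    and a1 a2 a3 a4 a13 a14 a21 a23 a32 a34 a41 a42 :: nat
  assumes "\<And>i. 0 < n i"
    and "Gcd (range n) = 1"
    and "n 1 < n 2" and "n 2 < n 3" and "n 3 < n 4"
    and "gorenstein_curve n"
    and "\<not> complete_intersection_curve TYPE('k::field) n"
    and "0 < a21" "a21 < a1" "0 < a41" "a41 < a1"
    and "0 < a32" "a32 < a2" "0 < a42" "a42 < a2"
    and "0 < a13" "a13 < a3" "0 < a23" "a23 < a3"
    and "0 < a14" "a14 < a4" "0 < a34" "a34 < a4"
    and "a1 = a21 + a41" and "a2 = a32 + a42" and "a3 = a13 + a23" and "a4 = a14 + a34"
    and "minimally_generates
           {var 1 ^ a1 - var 3 ^ a13 * var 4 ^ a14,
            var 2 ^ a2 - var 1 ^ a21 * var 3 ^ a23,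
            var 3 ^ a3 - var 2 ^ a32 * var 4 ^ a34,
            var 4 ^ a4 - var 1 ^ a41 * var 2 ^ a42,
            var 1 ^ a21 * var 4 ^ a34 - var 2 ^ a42 * var 3 ^ a13}
           (curve_ideal n :: (4, 'k::field) mpoly set)"
    and "a32 < a42"
    and "a14 \<le> a34"
  shows "cohen_macaulay_tangent_cone TYPE('k) n \<longleftrightarrow>
           a2 \<le> a21 + a23 \<and>
           a42 + a13 \<le> a21 + a34 \<and>
           a3 + a13 \<le> a1 + a32 + a34 - a14"
proof -
  define M where "M = {(vec4 a1 0 0 0, vec4 0 0 a13 a14), (vec4 0 a2 0 0, vec4 a21 0 a23 0),
    (vec4 0 0 a3 0, vec4 0 a32 0 a34), (vec4 0 0 0 a4, vec4 a41 a42 0 0),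
    (vec4 a21 0 0 a34, vec4 0 a42 a13 0)}"
  have gen: "ideal_gen ((\<lambda>(a, b). monomial_diff a b) ` M) = (curve_ideal n :: (4, 'k) mpoly set)"
    using assms(28) unfolding minimally_generates_def M_def
    by (simp add: monomial_diff_def vec4_def var_power mult_single)
  have weight: "weight n a = weight n b" if "(a, b) \<in> M" for a b
    by (rule weight_eq_of_generator[OF gen that])
  have closed: "Q i' j' k' l'"
    if "\<And>i j k l. Q (i + a1) j k l \<longleftrightarrow> Q i j (k + a13) (l + a14)"
      "\<And>i j k l. Q i (j + a2) k l \<longleftrightarrow> Q (i + a21) j (k + a23) l"
      "\<And>i j k l. Q i j (k + a3) l \<longleftrightarrow> Q i (j + a32) k (l + a34)"
      "\<And>i j k l. Q i j k (l + a4) \<longleftrightarrow> Q (i + a41) (j + a42) k l"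
      "\<And>i j k l. Q (i + a21) j k (l + a34) \<longleftrightarrow> Q i (j + a42) (k + a13) l"
      "n 1 * i + n 2 * j + n 3 * k + n 4 * l = n 1 * i' + n 2 * j' + n 3 * k' + n 4 * l'"
      "Q i j k l"
    for Q :: "nat \<Rightarrow> nat \<Rightarrow> nat \<Rightarrow> nat \<Rightarrow> bool" and i j k l i' j' k' l'
  proof -
    let ?C = "{m. Q (Poly_Mapping.lookup m 1) (Poly_Mapping.lookup m 2) (Poly_Mapping.lookup m 3)
      (Poly_Mapping.lookup m 4)}"
    note moves = that(1-5)
    have w: "weight n (vec4 i j k l) = weight n (vec4 i' j' k' l')"
      unfolding weight_vec4 by (rule that(6))
    have "m + a \<in> ?C \<longleftrightarrow> m + b \<in> ?C" if "(a, b) \<in> M" for a b m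
      using that moves unfolding M_def
      by (auto simp: lookup_add lookup_vec4)
    from move_closed_imp_weight_closed[OF gen this w]
    have "vec4 i j k l \<in> ?C \<longleftrightarrow> vec4 i' j' k' l' \<in> ?C" .
    then show ?thesis using that(7) by (simp add: lookup_vec4)
  qed
  have "n 1 < n i" if "i \<noteq> 1" for i
    using exhaust_4[of i] that assms(3-5) by auto
  then have "cohen_macaulay_tangent_cone TYPE('k) n \<longleftrightarrow>
      (\<forall>m. degree_maximal n m \<longrightarrow> degree_maximal n (m + Poly_Mapping.single 1 1))"
    using assms(1) by (rule cohen_macaulay_tangent_cone_iff)
  also have "\<dots> \<longleftrightarrow> (\<forall>m m'. weight n m = weight n m' \<and> 0 < Poly_Mapping.lookup m 1 \<longrightarrow>
      (\<exists>m''. weight n m'' = weight n m' \<and> 0 < Poly_Mapping.lookup m'' 1 \<and> mdeg m' \<le> mdeg m''))"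
    by (rule degree_maximal_add_axis_iff) (rule assms(1))
  also have "\<dots> \<longleftrightarrow> a2 \<le> a21 + a23 \<and> a42 + a13 \<le> a21 + a34 \<and> a3 + a13 \<le> a1 + a32 + a34 - a14"
    unfolding all_vec4 ex_vec4 weight_vec4 mdeg_vec4 lookup_vec4
  proof (rule degree_condition_iff)
    show "n 1 * a1 + n 2 * 0 + n 3 * 0 + n 4 * 0 = n 1 * 0 + n 2 * 0 + n 3 * a13 + n 4 * a14"
      "n 1 * 0 + n 2 * a2 + n 3 * 0 + n 4 * 0 = n 1 * a21 + n 2 * 0 + n 3 * a23 + n 4 * 0"
      "n 1 * 0 + n 2 * 0 + n 3 * a3 + n 4 * 0 = n 1 * 0 + n 2 * a32 + n 3 * 0 + n 4 * a34"
      "n 1 * 0 + n 2 * 0 + n 3 * 0 + n 4 * a4 = n 1 * a41 + n 2 * a42 + n 3 * 0 + n 4 * 0"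
      "n 1 * a21 + n 2 * 0 + n 3 * 0 + n 4 * a34 = n 1 * 0 + n 2 * a42 + n 3 * a13 + n 4 * 0"
      unfolding weight_vec4 [symmetric] by (rule weight, simp add: M_def)+
  qed (fact closed | use assms(1,3-5) assms(8-27,29-) in \<open>simp add: less_imp_le\<close>)+
  finally show ?thesis .
qed

end
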